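(* Let $G$ be a Helly $EPT$ graph and let $h\geq 3$ be an integer. Then $G\in$ Helly $[h,2,2]$ if and only if every atom of $G$ has at most $h$ cliques.
   Context: All graphs are finite and simple. An $EPT$ representation of a graph $G$ is a pair $\langle \mathcal{P},T\rangle$ where $T$ is a tree (the host tree) and $\mathcal{P}=(P_v)_{v\in V(G)}$ is a family of subpaths of $T$ such that two distinct vertices $v,w$ of $G$ are adjacent if and only if $E(P_v)\cap E(P_w)\neq\emptyset$. If the host tree has maximum degree $h$, the representation is an $(h,2,2)$-representation. A representation is Helly if the family $(E(P))_{P\in\mathcal{P}}$ has the Helly property (every pairwise intersecting subfamily has nonempty total intersection). $G$ is Helly $EPT$ if it has a Helly $EPT$ representation, and $G\in$ Helly $[h,2,2]$ if it has a Helly $(h,2,2)$-representation. A clique is a maximal complete set of vertices. A clique $C$ of a connected graph $H$ is a separator if $H-C$ (the subgraph induced by $V(H)\setminus C$) is disconnected. An atom is a connected graph with no clique separator. The atoms of a graph $G$ are the graphs obtained by the decomposition of $G$ by clique separators (Monma–Wei / Tarjan): $G$ is progressively decomposed along clique separators into a clique decomposition tree whose internal nodes correspond to clique separators and whose leaves correspond to atoms; equivalently, the atoms of $G$ are the maximal connected induced subgraphs of $G$ having no clique separator. The atoms of $G$ do not depend on the choice of decomposition. *)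

theory Defs
  imports Main
begin

definition simple_graph :: "'a set \<Rightarrow> ('a \<Rightarrow> 'a \<Rightarrow> bool) \<Rightarrow> bool" where
  "simple_graph V E \<longleftrightarrow> finite V \<and>
     (\<forall>u v. E u v \<longrightarrow> u \<in> V \<and> v \<in> V \<and> u \<noteq> v \<and> E v u)"

definition reach_in :: "'a set \<Rightarrow> ('a \<Rightarrow> 'a \<Rightarrow> bool) \<Rightarrow> 'a \<Rightarrow> 'a \<Rightarrow> bool" where
  "reach_in A E = (\<lambda>x y. x \<in> A \<and> y \<in> A \<and> E x y)\<^sup>*\<^sup>*"

definition connected_in :: "'a set \<Rightarrow> ('a \<Rightarrow> 'a \<Rightarrow> bool) \<Rightarrow> bool" where
  "connected_in A E \<longleftrightarrow> A \<noteq> {} \<and> (\<forall>u\<in>A. \<forall>v\<in>A. reach_in A E u v)"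

definition disconnected_in :: "'a set \<Rightarrow> ('a \<Rightarrow> 'a \<Rightarrow> bool) \<Rightarrow> bool" where
  "disconnected_in A E \<longleftrightarrow> (\<exists>u\<in>A. \<exists>v\<in>A. \<not> reach_in A E u v)"

definition complete_in :: "'a set \<Rightarrow> ('a \<Rightarrow> 'a \<Rightarrow> bool) \<Rightarrow> 'a set \<Rightarrow> bool" where
  "complete_in A E C \<longleftrightarrow> C \<subseteq> A \<and> (\<forall>u\<in>C. \<forall>v\<in>C. u \<noteq> v \<longrightarrow> E u v)"

definition is_clique :: "'a set \<Rightarrow> ('a \<Rightarrow> 'a \<Rightarrow> bool) \<Rightarrow> 'a set \<Rightarrow> bool" where
  "is_clique A E C \<longleftrightarrow> complete_in A E C \<and> (\<forall>D. complete_in A E D \<and> C \<subseteq> D \<longrightarrow> D = C)"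

definition cliques :: "'a set \<Rightarrow> ('a \<Rightarrow> 'a \<Rightarrow> bool) \<Rightarrow> 'a set set" where
  "cliques A E = {C. is_clique A E C}"

definition clique_separator :: "'a set \<Rightarrow> ('a \<Rightarrow> 'a \<Rightarrow> bool) \<Rightarrow> 'a set \<Rightarrow> bool" where
  "clique_separator A E C \<longleftrightarrow> is_clique A E C \<and> disconnected_in (A - C) E"

definition no_clique_separator :: "'a set \<Rightarrow> ('a \<Rightarrow> 'a \<Rightarrow> bool) \<Rightarrow> bool" where
  "no_clique_separator A E \<longleftrightarrow> (\<forall>C. \<not> clique_separator A E C)"

definition is_atom :: "'a set \<Rightarrow> ('a \<Rightarrow> 'a \<Rightarrow> bool) \<Rightarrow> 'a set \<Rightarrow> bool" where
  "is_atom V E A \<longleftrightarrow> A \<subseteq> V \<and> connected_in A E \<and> no_clique_separator A E \<and>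
     (\<forall>B. A \<subseteq> B \<and> B \<subseteq> V \<and> connected_in B E \<and> no_clique_separator B E \<longrightarrow> B = A)"

definition is_walk :: "nat set \<Rightarrow> nat set set \<Rightarrow> nat list \<Rightarrow> bool" where
  "is_walk VT ET xs \<longleftrightarrow> xs \<noteq> [] \<and> set xs \<subseteq> VT \<and>
     (\<forall>i. Suc i < length xs \<longrightarrow> {xs ! i, xs ! Suc i} \<in> ET)"

definition is_path :: "nat set \<Rightarrow> nat set set \<Rightarrow> nat list \<Rightarrow> bool" where
  "is_path VT ET xs \<longleftrightarrow> is_walk VT ET xs \<and> distinct xs"

definition is_cycle :: "nat set \<Rightarrow> nat set set \<Rightarrow> nat list \<Rightarrow> bool" where
  "is_cycle VT ET xs \<longleftrightarrow> is_path VT ET xs \<and> length xs \<ge> 3 \<and> {last xs, hd xs} \<in> ET"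

definition is_tree :: "nat set \<Rightarrow> nat set set \<Rightarrow> bool" where
  "is_tree VT ET \<longleftrightarrow> finite VT \<and> VT \<noteq> {} \<and>
     (\<forall>e\<in>ET. \<exists>u v. e = {u, v} \<and> u \<in> VT \<and> v \<in> VT \<and> u \<noteq> v) \<and>
     (\<forall>u\<in>VT. \<forall>v\<in>VT. \<exists>xs. is_path VT ET xs \<and> hd xs = u \<and> last xs = v) \<and>
     (\<forall>xs. \<not> is_cycle VT ET xs)"

definition path_edges :: "nat list \<Rightarrow> nat set set" where
  "path_edges xs = {{xs ! i, xs ! Suc i} | i. Suc i < length xs}"

definition degree :: "nat set set \<Rightarrow> nat \<Rightarrow> nat" where
  "degree ET x = card {e \<in> ET. x \<in> e}"

definition max_degree :: "nat set \<Rightarrow> nat set set \<Rightarrow> nat" where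
  "max_degree VT ET = Max (degree ET ` VT)"

definition ept_rep :: "'a set \<Rightarrow> ('a \<Rightarrow> 'a \<Rightarrow> bool) \<Rightarrow> nat set \<Rightarrow> nat set set \<Rightarrow> ('a \<Rightarrow> nat list) \<Rightarrow> bool" where
  "ept_rep V E VT ET P \<longleftrightarrow> is_tree VT ET \<and>
     (\<forall>v\<in>V. is_path VT ET (P v) \<and> length (P v) \<ge> 2) \<and>
     (\<forall>v\<in>V. \<forall>w\<in>V. v \<noteq> w \<longrightarrow> (E v w \<longleftrightarrow> path_edges (P v) \<inter> path_edges (P w) \<noteq> {}))"

definition helly_rep :: "'a set \<Rightarrow> ('a \<Rightarrow> nat list) \<Rightarrow> bool" where
  "helly_rep V P \<longleftrightarrow> (\<forall>S. S \<subseteq> V \<and> S \<noteq> {} \<and>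
       (\<forall>v\<in>S. \<forall>w\<in>S. path_edges (P v) \<inter> path_edges (P w) \<noteq> {})
       \<longrightarrow> (\<Inter>v\<in>S. path_edges (P v)) \<noteq> {})"

definition helly_ept :: "'a set \<Rightarrow> ('a \<Rightarrow> 'a \<Rightarrow> bool) \<Rightarrow> bool" where
  "helly_ept V E \<longleftrightarrow> (\<exists>VT ET P. ept_rep V E VT ET P \<and> helly_rep V P)"

definition helly_h22 :: "nat \<Rightarrow> 'a set \<Rightarrow> ('a \<Rightarrow> 'a \<Rightarrow> bool) \<Rightarrow> bool" where
  "helly_h22 h V E \<longleftrightarrow>
     (\<exists>VT ET P. ept_rep V E VT ET P \<and> helly_rep V P \<and> max_degree VT ET = h)"

end

theory Submission
  imports Defs
begin

text \<open>In a Helly representation every clique consists of the paths through some tree edge. If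
  the represented graph has no clique separator, no tree edge can have two such clique edges on
  either side, so some node sees all clique edges in different branches and its degree bounds the
  number of cliques.

  Conversely, take a node of degree greater than h and link two of its neighbours when some path
  passes from one to the other. If the link minus some neighbour i is disconnected, the node can be
  split into two nodes of smaller degree in such a way that all paths using the new edge share the
  edge to i; the represented graph and the Helly property do not change. Otherwise the paths passing
  through the node induce a connected graph without clique separator whose cliques correspond to the
  neighbours, and the atom containing it has more than h cliques.\<close>

section \<open>Edges of vertex lists\<close>

text \<open>The link criterion comes from a line graph. Two paths passing through \<open>w\<close>
  share an edge iff they share a neighbour of \<open>w\<close>, so they induce the line graph of the
  link, with parallel link edges allowed. By the Helly property every clique of this graph is a star
  of the link, not a triangle. Deleting a clique therefore amounts to deleting one link vertex
  \<open>i\<close>, and a cut vertex of the link is a place to split.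

  After a split, two paths can newly meet only on the added edge, and the cut is chosen so that such
  paths already share \<open>{w, i}\<close>. Parts of sizes a and b at \<open>w\<close> yield nodes
  of degrees a + 1 and b + 1 in place of a + b. These are smaller only if both parts have at least
  two elements, which needs degree at least 4; this is where \<open>h \<ge> 3\<close> enters. The
  total degree of the tree grows with every split, so termination needs a convex weight, the sum of
  \<open>3 ^ degree\<close>.

  Splitting only gives maximum degree at most \<open>h\<close>, whereas exactly \<open>h\<close> is
  demanded; pendant leaves make up the difference.\<close>

lemma path_edges_Nil [simp]: "path_edges [] = {}"
  by (simp add: path_edges_def)

lemma path_edges_single [simp]: "path_edges [x] = {}"
  by (simp add: path_edges_def)

lemma path_edges_Cons [simp]:
  "path_edges (x # y # zs) = insert {x, y} (path_edges (y # zs))"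
proof -
  have "path_edges (x # y # zs) =
      (\<lambda>i. {(x # y # zs) ! i, (x # y # zs) ! Suc i}) ` {i. Suc i < length (x # y # zs)}"
    unfolding path_edges_def by auto
  also have "{i. Suc i < length (x # y # zs)} = insert 0 (Suc ` {i. Suc i < length (y # zs)})"
    using less_Suc_eq_0_disj by auto
  also have "(\<lambda>i. {(x # y # zs) ! i, (x # y # zs) ! Suc i}) ` \<dots> =
      insert {x, y} ((\<lambda>i. {(y # zs) ! i, (y # zs) ! Suc i}) ` {i. Suc i < length (y # zs)})"
    by (simp add: image_image)
  finally show ?thesis
    unfolding path_edges_def by auto
qed

lemma path_edges_Cons':
  "path_edges (x # zs) = (if zs = [] then {} else insert {x, hd zs} (path_edges zs))"
  by (cases zs) auto

lemma path_edges_append: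
  "xs \<noteq> [] \<Longrightarrow> ys \<noteq> [] \<Longrightarrow>
    path_edges (xs @ ys) = insert {last xs, hd ys} (path_edges xs \<union> path_edges ys)"
  by (induction xs) (auto simp: path_edges_Cons')

lemma path_edges_split:
  "path_edges (ys @ w # zs) = path_edges ys \<union> path_edges zs
     \<union> (if ys = [] then {} else {{last ys, w}}) \<union> (if zs = [] then {} else {{w, hd zs}})"
  by (cases "ys = []") (auto simp: path_edges_append path_edges_Cons')

lemma path_edges_subset_set: "e \<in> path_edges xs \<Longrightarrow> e \<subseteq> set xs"
  unfolding path_edges_def by auto

lemma path_edges_not_empty: "length xs \<ge> 2 \<Longrightarrow> path_edges xs \<noteq> {}"
  unfolding path_edges_def by (auto intro!: exI[of _ 0])

lemma is_walk_iff: "is_walk VT ET xs \<longleftrightarrow> xs \<noteq> [] \<and> set xs \<subseteq> VT \<and> path_edges xs \<subseteq> ET"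
  unfolding is_walk_def path_edges_def by auto

lemma is_path_iff:
  "is_path VT ET xs \<longleftrightarrow> xs \<noteq> [] \<and> set xs \<subseteq> VT \<and> path_edges xs \<subseteq> ET \<and> distinct xs"
  unfolding is_path_def is_walk_iff by auto

text \<open>A discrete intermediate value argument. Since edges are unordered, the list may take the
  crossing step in either direction.\<close>

lemma path_edges_crossing:
  "\<lbrakk>p \<in> set xs; p \<in> S; q \<in> set xs; q \<notin> S\<rbrakk> \<Longrightarrow> \<exists>a b. {a, b} \<in> path_edges xs \<and> a \<in> S \<and> b \<notin> S"
proof (induction xs arbitrary: p q)
  case Nil
  then show ?case by simp
next
  case (Cons x xs)
  show ?case
  proof (cases "\<exists>a b. a \<in> set xs \<and> b \<in> set xs \<and> a \<in> S \<and> b \<notin> S")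
    case True
    then have "\<exists>a b. {a, b} \<in> path_edges xs \<and> a \<in> S \<and> b \<notin> S"
      using Cons.IH by blast
    moreover have "xs \<noteq> []"
      using True by auto
    ultimately show ?thesis
      by (auto simp: path_edges_Cons')
  next
    case False
    have ne: "xs \<noteq> []"
      using Cons.prems by auto
    then have "hd xs \<in> S \<longleftrightarrow> x \<notin> S"
      using Cons.prems False hd_in_set[OF ne] by auto
    moreover have "{x, hd xs} \<in> path_edges (x # xs)" "{hd xs, x} \<in> path_edges (x # xs)"
      using ne by (auto simp: path_edges_Cons' insert_commute)
    ultimately show ?thesis
      by blast
  qed
qed

lemma path_edges_at:
  assumes "distinct (ys @ w # zs)" "{w, x} \<in> path_edges (ys @ w # zs)"
  shows "ys \<noteq> [] \<and> x = last ys \<or> zs \<noteq> [] \<and> x = hd zs"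
proof -
  have "{w, x} \<notin> path_edges ys" "{w, x} \<notin> path_edges zs"
    using assms(1) path_edges_subset_set by fastforce+
  then show ?thesis
    using assms by (auto simp: path_edges_split doubleton_eq_iff split: if_splits)
qed

lemma path_edges_at_most_two:
  assumes "distinct xs" "{w, x} \<in> path_edges xs" "{w, y} \<in> path_edges xs"
    "{w, z} \<in> path_edges xs" "x \<noteq> y"
  shows "z = x \<or> z = y"
proof -
  have "w \<in> set xs"
    using assms(2) path_edges_subset_set by blast
  then obtain ys zs where "xs = ys @ w # zs"
    by (meson split_list)
  then show ?thesis
    using assms path_edges_at by metis
qed


section \<open>Reachability and branches of a tree\<close>

lemma reach_in_refl: "reach_in A R x x"
  unfolding reach_in_def by simp

lemma reach_in_trans: "reach_in A R x y \<Longrightarrow> reach_in A R y z \<Longrightarrow> reach_in A R x z"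
  unfolding reach_in_def by simp

lemma reach_in_edge: "x \<in> A \<Longrightarrow> y \<in> A \<Longrightarrow> R x y \<Longrightarrow> reach_in A R x y"
  unfolding reach_in_def by auto

lemma reach_in_sym:
  assumes "\<And>x y. R x y \<Longrightarrow> R y x" "reach_in A R x y"
  shows "reach_in A R y x"
  using assms(2) unfolding reach_in_def
proof (induction rule: rtranclp_induct)
  case (step y z)
  have "(\<lambda>x y. x \<in> A \<and> y \<in> A \<and> R x y) z y"
    using step.hyps(2) assms(1) by blast
  then show ?case
    using step.IH by (rule converse_rtranclp_into_rtranclp)
qed simp

lemma reach_in_mono: "A \<subseteq> B \<Longrightarrow> reach_in A R x y \<Longrightarrow> reach_in B R x y"
  unfolding reach_in_def by (erule rtranclp_mono[THEN predicate2D, rotated]) auto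

text \<open>Induction along a walk, phrased with an invariant set. Below, \<open>S\<close> is
  typically one side of a cut or the set of targets already known to be reachable.\<close>

lemma reach_in_closed:
  assumes "reach_in A R x y" "x \<in> S" "\<And>a b. a \<in> A \<Longrightarrow> b \<in> A \<Longrightarrow> R a b \<Longrightarrow> a \<in> S \<Longrightarrow> b \<in> S"
  shows "y \<in> S"
  using assms(1,2) unfolding reach_in_def
  by (induction rule: rtranclp_induct) (use assms(3) in auto)

abbreviation adj :: "nat set set \<Rightarrow> nat \<Rightarrow> nat \<Rightarrow> bool" where
  "adj ET \<equiv> \<lambda>a b. {a, b} \<in> ET"

lemma reach_adj_sym: "reach_in A (adj ET) x y \<Longrightarrow> reach_in A (adj ET) y x"
  by (rule reach_in_sym) (simp_all add: insert_commute)

lemma reach_in_imp_path: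
  assumes "reach_in A (adj ET) u v" "v \<in> A"
  shows "\<exists>xs. is_path A ET xs \<and> hd xs = u \<and> last xs = v"
  using assms(1) unfolding reach_in_def
proof (induction rule: converse_rtranclp_induct)
  case base
  show ?case
    using assms(2) by (intro exI[of _ "[v]"]) (auto simp: is_path_iff)
next
  case (step u y)
  then obtain xs where xs: "is_path A ET xs" "hd xs = y" "last xs = v"
    by blast
  show ?case
  proof (cases "u \<in> set xs")
    \<comment> \<open>Prefixing \<open>u\<close> would repeat a vertex, so the suffix of the path
      that starts at \<open>u\<close> is used instead.\<close>
    case True
    then obtain as bs where "xs = as @ u # bs"
      by (meson split_list)
    then show ?thesis
      using xs by (intro exI[of _ "u # bs"]) (cases "as = []"; auto simp: is_path_iff path_edges_append)
  next
    case False
    then show ?thesis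
      using xs step.hyps by (intro exI[of _ "u # xs"]) (auto simp: is_path_iff path_edges_Cons')
  qed
qed

lemma walk_imp_reach_in:
  "set xs \<subseteq> A \<Longrightarrow> path_edges xs \<subseteq> ET \<Longrightarrow> p \<in> set xs \<Longrightarrow> reach_in A (adj ET) (hd xs) p"
proof (induction xs arbitrary: p)
  case (Cons x xs)
  show ?case
  proof (cases "p = x")
    case False
    then have ne: "xs \<noteq> []" and p: "p \<in> set xs"
      using Cons.prems by auto
    have "reach_in A (adj ET) (hd xs) p"
      using Cons.IH Cons.prems p ne by (auto simp: path_edges_Cons')
    moreover have "reach_in A (adj ET) x (hd xs)"
      using Cons.prems ne hd_in_set[OF ne] by (intro reach_in_edge) (auto simp: path_edges_Cons')
    ultimately show ?thesis
      using reach_in_trans by fastforce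
  qed (simp add: reach_in_refl)
qed simp

section \<open>Components of the host tree minus a node\<close>

definition nbrs :: "nat set set \<Rightarrow> nat \<Rightarrow> nat set" where
  "nbrs ET w = {x. {w, x} \<in> ET}"

text \<open>For a neighbour \<open>x\<close> of \<open>w\<close> this is the component of the tree
  minus \<open>w\<close> that contains \<open>x\<close>. The pair of \<open>w\<close> and
  \<open>x\<close> acts as a directed edge, and the branch is the side it points to.\<close>

definition branch :: "nat set \<Rightarrow> nat set set \<Rightarrow> nat \<Rightarrow> nat \<Rightarrow> nat set" where
  "branch VT ET w x = {y. reach_in (VT - {w}) (adj ET) x y}"

locale host_tree =
  fixes VT :: "nat set" and ET :: "nat set set"
  assumes tree: "is_tree VT ET"
begin

lemma finite_VT: "finite VT" and VT_nonempty: "VT \<noteq> {}"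
  using tree unfolding is_tree_def by auto

lemma edge_ends: "{a, b} \<in> ET \<Longrightarrow> a \<in> VT \<and> b \<in> VT \<and> a \<noteq> b"
  using tree unfolding is_tree_def by (fastforce simp: doubleton_eq_iff)

lemma edgeE:
  assumes "e \<in> ET"
  obtains a b where "e = {a, b}" "a \<in> VT" "b \<in> VT" "a \<noteq> b"
  using tree assms unfolding is_tree_def by blast

lemma nbrs_subset: "nbrs ET w \<subseteq> VT - {w}"
  using edge_ends unfolding nbrs_def by auto

lemma finite_nbrs: "finite (nbrs ET w)"
  using nbrs_subset finite_VT by (meson finite_Diff finite_subset)

lemma degree_eq: "degree ET w = card (nbrs ET w)"
proof -
  have "{e \<in> ET. w \<in> e} = (\<lambda>x. {w, x}) ` nbrs ET w"
  proof (intro equalityI subsetI)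
    fix e assume "e \<in> {e \<in> ET. w \<in> e}"
    moreover from this obtain a b where "e = {a, b}"
      by (blast elim: edgeE)
    ultimately show "e \<in> (\<lambda>x. {w, x}) ` nbrs ET w"
      by (auto simp: nbrs_def insert_commute)
  qed (auto simp: nbrs_def)
  moreover have "inj_on (\<lambda>x. {w, x}) (nbrs ET w)"
    by (auto simp: inj_on_def doubleton_eq_iff)
  ultimately show ?thesis
    unfolding degree_def by (simp add: card_image)
qed

lemma reach: "u \<in> VT \<Longrightarrow> v \<in> VT \<Longrightarrow> reach_in VT (adj ET) u v"
proof -
  assume "u \<in> VT" "v \<in> VT"
  then obtain xs where xs: "is_path VT ET xs" "hd xs = u" "last xs = v"
    using tree unfolding is_tree_def by blast
  show ?thesis
    using walk_imp_reach_in[of xs VT ET "last xs"] xs last_in_set[of xs] by (auto simp: is_path_iff)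
qed

lemma branch_root: "x \<in> branch VT ET w x"
  by (simp add: branch_def reach_in_refl)

lemma branch_subset:
  assumes "x \<in> nbrs ET w" shows "branch VT ET w x \<subseteq> VT - {w}"
proof
  fix y assume "y \<in> branch VT ET w x"
  then have "reach_in (VT - {w}) (adj ET) x y"
    by (simp add: branch_def)
  then show "y \<in> VT - {w}"
    by (rule reach_in_closed) (use assms nbrs_subset in auto)
qed

text \<open>A path from \<open>x\<close> to \<open>x'\<close> avoiding \<open>w\<close> would close
  up through \<open>w\<close> to a cycle. Later arguments draw on the acyclicity of the host tree
  through this fact.\<close>

lemma branch_unique:
  assumes "x \<in> nbrs ET w" "x' \<in> nbrs ET w" "y \<in> branch VT ET w x" "y \<in> branch VT ET w x'"
  shows "x = x'"
proof (rule ccontr)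
  assume ne: "x \<noteq> x'"
  have "reach_in (VT - {w}) (adj ET) x x'"
    using reach_in_trans[OF _ reach_adj_sym] assms(3,4) unfolding branch_def mem_Collect_eq .
  moreover have "x' \<in> VT - {w}"
    using assms(2) nbrs_subset by blast
  ultimately obtain xs where xs: "is_path (VT - {w}) ET xs" "hd xs = x" "last xs = x'"
    using reach_in_imp_path by metis
  then have "length xs \<ge> 2"
    using ne by (cases xs rule: remdups_adj.cases) (auto simp: is_path_iff)
  then have "is_cycle VT ET (w # xs)"
    using xs assms(1,2) edge_ends unfolding is_cycle_def is_path_iff
    by (auto simp: path_edges_Cons' nbrs_def insert_commute)
  then show False
    using tree unfolding is_tree_def by blast
qed

text \<open>Every tree edge is a bridge: a step that avoids \<open>w\<close> stays in the branch, so
  a leaving step ends in \<open>w\<close>, and uniqueness of branches identifies its start as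
  \<open>x\<close>.\<close>

lemma branch_crossing:
  assumes "x \<in> nbrs ET w" "{a, b} \<in> ET" "a \<in> branch VT ET w x" "b \<notin> branch VT ET w x"
  shows "a = x \<and> b = w"
proof -
  have a: "a \<in> VT - {w}"
    using assms(1,3) branch_subset by blast
  have b: "b = w"
  proof (rule ccontr)
    assume "b \<noteq> w"
    then have "reach_in (VT - {w}) (adj ET) a b"
      using a assms(2) edge_ends by (intro reach_in_edge) auto
    then have "reach_in (VT - {w}) (adj ET) x b"
      using assms(3) reach_in_trans[of _ _ x a b] by (simp add: branch_def)
    then show False
      using assms(4) by (simp add: branch_def)
  qed
  then have "a \<in> nbrs ET w"
    using assms(2) by (simp add: nbrs_def insert_commute)
  then show ?thesis
    using b branch_unique[OF _ assms(1) branch_root assms(3)] by simp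
qed

lemma in_some_branch:
  assumes "w \<in> VT" "y \<in> VT" "y \<noteq> w"
  obtains x where "x \<in> nbrs ET w" "y \<in> branch VT ET w x"
proof -
  obtain xs where xs: "is_path VT ET xs" "hd xs = w" "last xs = y"
    using tree assms unfolding is_tree_def by blast
  then obtain zs where zs: "xs = w # zs"
    by (cases xs) (auto simp: is_path_iff)
  then have ne: "zs \<noteq> []" and last: "last zs = y"
    using xs assms(3) by auto
  have "hd zs \<in> nbrs ET w"
    using xs zs ne by (auto simp: is_path_iff path_edges_Cons' nbrs_def)
  moreover have "reach_in (VT - {w}) (adj ET) (hd zs) y"
    using xs zs ne last by (intro walk_imp_reach_in) (auto simp: is_path_iff path_edges_Cons')
  ultimately show ?thesis
    using that unfolding branch_def by blast
qed

lemma branch_path_edge: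
  assumes "is_path VT ET xs" "x \<in> nbrs ET w" "p \<in> set xs" "p \<in> branch VT ET w x"
    "q \<in> set xs" "q \<notin> branch VT ET w x"
  shows "{w, x} \<in> path_edges xs"
proof -
  obtain a b where "{a, b} \<in> path_edges xs" "a \<in> branch VT ET w x" "b \<notin> branch VT ET w x"
    using path_edges_crossing[OF assms(3-6)] by blast
  moreover from this have "a = x \<and> b = w"
    using assms(1,2) branch_crossing unfolding is_path_iff by blast
  ultimately show ?thesis
    by (simp add: insert_commute)
qed

text \<open>These are the two sides of the edge \<open>{w, x}\<close>. The only edge into the first
  side enters at \<open>x\<close>, so a walk that starts at \<open>w\<close> and avoids
  \<open>x\<close> never gets there.\<close>

lemma branch_disjoint:
  assumes "x \<in> nbrs ET w"
  shows "branch VT ET w x \<inter> branch VT ET x w = {}"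
proof -
  have w: "w \<in> nbrs ET x"
    using assms by (simp add: nbrs_def insert_commute)
  have "z \<notin> branch VT ET w x" if "z \<in> branch VT ET x w" for z
  proof -
    have "reach_in (VT - {x}) (adj ET) w z"
      using that by (simp add: branch_def)
    then have "z \<in> - branch VT ET w x"
    proof (rule reach_in_closed)
      show "w \<in> - branch VT ET w x"
        using branch_subset assms by blast
      fix a b assume "a \<in> VT - {x}" "b \<in> VT - {x}" "{a, b} \<in> ET" "a \<in> - branch VT ET w x"
      then show "b \<in> - branch VT ET w x"
        using branch_crossing[OF assms, of b a] by (auto simp: insert_commute)
    qed
    then show ?thesis by simp
  qed
  then show ?thesis by blast
qed

text \<open>Moving on along a directed edge without turning back shrinks the branch. Strictness,
  witnessed by \<open>x\<close>, is what makes a branch of least size useful.\<close>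

lemma branch_nested:
  assumes "x \<in> nbrs ET w" "y \<in> nbrs ET x" "y \<noteq> w"
  shows "branch VT ET x y \<subset> branch VT ET w x"
proof -
  have "z \<in> branch VT ET w x" if "z \<in> branch VT ET x y" for z
  proof -
    have "reach_in (VT - {x}) (adj ET) y z"
      using that by (simp add: branch_def)
    then show ?thesis
    proof (rule reach_in_closed)
      show "y \<in> branch VT ET w x"
        using branch_crossing[OF assms(1) _ branch_root, of y] assms by (auto simp: nbrs_def)
      fix a b assume "a \<in> VT - {x}" "b \<in> VT - {x}" "{a, b} \<in> ET" "a \<in> branch VT ET w x"
      then show "b \<in> branch VT ET w x"
        using branch_crossing[OF assms(1), of a b] by auto
    qed
  qed
  moreover have "x \<notin> branch VT ET x y"
    using branch_subset[OF assms(2)] by blast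
  ultimately show ?thesis
    using branch_root by blast
qed

end


text \<open>Take the cut belonging to the closing edge of a cycle. The remaining open path joins the
  same two sides, so it crosses the cut as well and must contain the closing edge; a distinct list
  of length at least 3 does not contain the edge between its ends.\<close>

lemma acyclic_if_bridges:
  assumes "\<And>e. e \<in> ET \<Longrightarrow> \<exists>a b S. e = {a, b} \<and> a \<in> S \<and> b \<notin> S \<and>
      (\<forall>c d. {c, d} \<in> ET \<and> c \<in> S \<and> d \<notin> S \<longrightarrow> {c, d} = e)"
  shows "\<not> is_cycle VT ET xs"
proof
  assume cyc: "is_cycle VT ET xs"
  then have xs: "xs \<noteq> []" "distinct xs" "path_edges xs \<subseteq> ET" "length xs \<ge> 3"
      and e: "{last xs, hd xs} \<in> ET"
    unfolding is_cycle_def is_path_iff by auto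
  obtain a b S where S: "{last xs, hd xs} = {a, b}" "a \<in> S" "b \<notin> S"
      "\<And>c d. {c, d} \<in> ET \<Longrightarrow> c \<in> S \<Longrightarrow> d \<notin> S \<Longrightarrow> {c, d} = {last xs, hd xs}"
    using assms[OF e] by metis
  have "{a, b} \<subseteq> set xs"
    using S(1) xs(1) hd_in_set last_in_set by (metis empty_subsetI insert_subset)
  then obtain c d where "{c, d} \<in> path_edges xs" "c \<in> S" "d \<notin> S"
    using path_edges_crossing[of a xs S b] S by auto
  then have "{last xs, hd xs} \<in> path_edges xs"
    using S(4) xs(3) by (metis subsetD)
  moreover obtain x ys z where "xs = x # ys @ [z]" "ys \<noteq> []"
  proof -
    obtain x ys' where "xs = x # ys'" "length ys' \<ge> 2"
      using xs by (cases xs) auto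
    moreover from this obtain ys z where "ys' = ys @ [z]"
      by (cases ys' rule: rev_cases) auto
    ultimately show thesis
      using that[of x ys z] by (cases ys) auto
  qed
  ultimately show False
    using xs(2) path_edges_at[of "[]" x "ys @ [z]" z]
    by (cases ys) (auto simp: insert_commute)
qed


section \<open>Splitting a node of the host tree\<close>

definition moved :: "nat \<Rightarrow> nat \<Rightarrow> nat set \<Rightarrow> nat set \<Rightarrow> nat set" where
  "moved w w' J e = (if \<exists>x\<in>J. e = {w, x} then insert w' (e - {w}) else e)"

text \<open>The inverse of contracting \<open>{w, w'}\<close>: the neighbours in \<open>J\<close> go
  to the new node and the others stay at \<open>w\<close>. With \<open>J\<close> empty this attaches
  a pendant leaf.\<close>

definition split_edges :: "nat set set \<Rightarrow> nat \<Rightarrow> nat \<Rightarrow> nat set \<Rightarrow> nat set set" where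
  "split_edges ET w w' J = insert {w, w'} (moved w w' J ` ET)"

text \<open>These are the paths that have to run along \<open>{w, w'}\<close> once the node is
  split.\<close>

definition crosses :: "nat set set \<Rightarrow> nat \<Rightarrow> nat set \<Rightarrow> nat list \<Rightarrow> bool" where
  "crosses ET w J xs \<longleftrightarrow> (\<exists>x\<in>J. \<exists>y\<in>nbrs ET w - J. {w, x} \<in> path_edges xs \<and> {w, y} \<in> path_edges xs)"

locale node_split = host_tree +
  fixes w w' :: nat and J :: "nat set"
  assumes w: "w \<in> VT" and w': "w' \<notin> VT" and J: "J \<subseteq> nbrs ET w"
begin

lemma w_neq_w': "w \<noteq> w'"
  using w w' by blast

lemma J_VT: "x \<in> J \<Longrightarrow> x \<in> VT \<and> x \<noteq> w \<and> x \<noteq> w'"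
  using J nbrs_subset w' by blast

lemma moved_J: "x \<in> J \<Longrightarrow> moved w w' J {w, x} = {w', x}"
  using J_VT unfolding moved_def by auto

lemma moved_other: "\<forall>x\<in>J. e \<noteq> {w, x} \<Longrightarrow> moved w w' J e = e"
  unfolding moved_def by auto

lemma split_edges_iff:
  "e \<in> split_edges ET w w' J \<longleftrightarrow>
     e = {w, w'} \<or> (\<exists>x\<in>J. e = {w', x}) \<or> e \<in> ET \<and> (\<forall>x\<in>J. e \<noteq> {w, x})"
proof -
  have "e \<in> moved w w' J ` ET \<longleftrightarrow> (\<exists>x\<in>J. e = {w', x}) \<or> e \<in> ET \<and> (\<forall>x\<in>J. e \<noteq> {w, x})"
  proof
    assume "e \<in> moved w w' J ` ET"
    then obtain f where "f \<in> ET" "e = moved w w' J f"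
      by blast
    then show "(\<exists>x\<in>J. e = {w', x}) \<or> e \<in> ET \<and> (\<forall>x\<in>J. e \<noteq> {w, x})"
      by (metis moved_J moved_other)
  next
    assume "(\<exists>x\<in>J. e = {w', x}) \<or> e \<in> ET \<and> (\<forall>x\<in>J. e \<noteq> {w, x})"
    then show "e \<in> moved w w' J ` ET"
    proof (elim disjE bexE conjE)
      fix x assume "x \<in> J" "e = {w', x}"
      then show ?thesis
        using moved_J[of x] J unfolding nbrs_def by (metis image_eqI mem_Collect_eq subsetD)
    next
      assume "e \<in> ET" "\<forall>x\<in>J. e \<noteq> {w, x}"
      then show ?thesis
        using moved_other by (metis image_eqI)
    qed
  qed
  then show ?thesis
    unfolding split_edges_def by blast
qed

lemma w'_notin_edge: "e \<in> ET \<Longrightarrow> w' \<notin> e"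
  using w' by (auto elim: edgeE)

text \<open>The fresh node \<open>w'\<close> occurs in the image of an edge exactly when that edge
  was moved, so no moved edge can collide with an unmoved one.\<close>

lemma inj_moved: "inj_on (moved w w' J) ET"
proof (rule inj_onI)
  fix e f assume e: "e \<in> ET" and f: "f \<in> ET" and eq: "moved w w' J e = moved w w' J f"
  have w'_iff: "w' \<in> moved w w' J g \<longleftrightarrow> (\<exists>x\<in>J. g = {w, x})" if "g \<in> ET" for g
    using w'_notin_edge[OF that] unfolding moved_def by auto
  show "e = f"
  proof (cases "\<exists>x\<in>J. e = {w, x}")
    case True
    moreover from this have "\<exists>x\<in>J. f = {w, x}"
      using w'_iff e f eq by metis
    ultimately show ?thesis
      using eq moved_J J_VT by (auto simp: doubleton_eq_iff)
  next
    case False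
    moreover from this have "\<not> (\<exists>x\<in>J. f = {w, x})"
      using w'_iff e f eq by metis
    ultimately show ?thesis
      using eq moved_other by metis
  qed
qed

lemma new_edge_not_moved: "{w, w'} \<notin> moved w w' J ` ET"
proof
  assume "{w, w'} \<in> moved w w' J ` ET"
  then obtain f where f: "f \<in> ET" "{w, w'} = moved w w' J f"
    by blast
  show False
  proof (cases "\<exists>x\<in>J. f = {w, x}")
    case True
    then obtain x where "x \<in> J" "{w, w'} = {w', x}"
      using f moved_J by metis
    then show False
      using J_VT w_neq_w' by (auto simp: doubleton_eq_iff)
  next
    case False
    then show False
      using f moved_other w'_notin_edge by (metis insertI1 insert_commute)
  qed
qed

lemma nbrs_split_w: "nbrs (split_edges ET w w' J) w = insert w' (nbrs ET w - J)"
  using J_VT w_neq_w' by (auto simp: nbrs_def split_edges_iff doubleton_eq_iff)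

lemma nbrs_split_w': "nbrs (split_edges ET w w' J) w' = insert w J"
  using J_VT w_neq_w' w'_notin_edge by (auto simp: nbrs_def split_edges_iff doubleton_eq_iff)

lemma nbrs_split_other:
  assumes "z \<in> VT" "z \<noteq> w"
  shows "nbrs (split_edges ET w w' J) z =
    (if z \<in> J then insert w' (nbrs ET z - {w}) else nbrs ET z)"
  using assms J_VT w_neq_w' w' by (auto simp: nbrs_def split_edges_iff doubleton_eq_iff)

lemma reach_split:
  assumes "u \<in> insert w' VT"
  shows "reach_in (insert w' VT) (adj (split_edges ET w w' J)) w u"
proof -
  let ?R = "reach_in (insert w' VT) (adj (split_edges ET w w' J))"
  have edge: "?R a b" if "{a, b} \<in> split_edges ET w w' J" "a \<in> insert w' VT" "b \<in> insert w' VT" for a b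
    using that by (intro reach_in_edge)
  have ww': "?R w w'"
    using w by (intro edge) (auto simp: split_edges_iff)
  have w'x: "?R w' x" if "x \<in> J" for x
    using that J_VT by (intro edge) (auto simp: split_edges_iff)
  \<comment> \<open>Each old edge is simulated in the new tree, a moved edge \<open>{w, x}\<close>
    by the detour from \<open>w\<close> over \<open>w'\<close> to \<open>x\<close>.\<close>
  have old: "?R a b" if ab: "{a, b} \<in> ET" for a b
  proof (cases "\<exists>x\<in>J. {a, b} = {w, x}")
    case True
    then obtain x where x: "x \<in> J" "a = w \<and> b = x \<or> a = x \<and> b = w"
      by (auto simp: doubleton_eq_iff)
    have "?R w x"
      using reach_in_trans[OF ww' w'x[OF x(1)]] .
    then show ?thesis
      using x(2) reach_adj_sym by auto
  next
    case False
    then show ?thesis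
      using ab edge_ends by (intro edge) (auto simp: split_edges_iff)
  qed
  have "?R w u" if "u \<in> VT"
  proof -
    have "reach_in VT (adj ET) w u"
      using reach w that by blast
    then have "u \<in> {u. ?R w u}"
    proof (rule reach_in_closed)
      fix a b assume "{a, b} \<in> ET" "a \<in> {u. ?R w u}"
      then show "b \<in> {u. ?R w u}"
        using reach_in_trans[OF _ old] by blast
    qed (simp add: reach_in_refl)
    then show ?thesis by simp
  qed
  then show ?thesis
    using assms ww' by blast
qed

text \<open>Each edge gets a cut inherited from the old tree: for \<open>{w, w'}\<close> the
  branches of \<open>J\<close> together with \<open>w'\<close>, for a moved edge the old branch of
  \<open>x\<close>, and for any other edge its old side.\<close>

lemma split_bridge:
  assumes "e \<in> split_edges ET w w' J"
  shows "\<exists>a b S. e = {a, b} \<and> a \<in> S \<and> b \<notin> S \<and>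
      (\<forall>c d. {c, d} \<in> split_edges ET w w' J \<and> c \<in> S \<and> d \<notin> S \<longrightarrow> {c, d} = e)"
  using assms[unfolded split_edges_iff]
proof (elim disjE bexE conjE)
  assume e: "e = {w, w'}"
  define S where "S = insert w' (\<Union>x\<in>J. branch VT ET w x)"
  have wS: "w \<notin> S"
    using branch_subset J w_neq_w' unfolding S_def by blast
  have "{c, d} = e" if t: "{c, d} \<in> split_edges ET w w' J" "c \<in> S" "d \<notin> S" for c d
    using t(1)[unfolded split_edges_iff]
  proof (elim disjE bexE conjE)
    fix x assume "x \<in> J" "{c, d} = {w', x}"
    then have False
      using t(2,3) branch_root unfolding S_def by (auto simp: doubleton_eq_iff)
    then show ?thesis ..
  next
    assume cd: "{c, d} \<in> ET" "\<forall>x\<in>J. {c, d} \<noteq> {w, x}"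
    then have "c \<noteq> w'"
      using w'_notin_edge by blast
    then obtain x where "x \<in> J" "c \<in> branch VT ET w x"
      using t(2) unfolding S_def by blast
    then show ?thesis
      using branch_crossing[of x w c d] cd t(3) J unfolding S_def by (auto simp: insert_commute)
  qed (use e in simp)
  then show ?thesis
    using e wS by (intro exI[of _ w'] exI[of _ w] exI[of _ S]) (auto simp: S_def insert_commute)
next
  fix x assume x: "x \<in> J" "e = {w', x}"
  have xN: "x \<in> nbrs ET w"
    using x J by blast
  have w'S: "w' \<notin> branch VT ET w x" "w \<notin> branch VT ET w x"
    using branch_subset[OF xN] w' by auto
  have "{c, d} = e" if "{c, d} \<in> split_edges ET w w' J"
      "c \<in> branch VT ET w x" "d \<notin> branch VT ET w x" for c d
    using that(1)[unfolded split_edges_iff]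
  proof (elim disjE bexE conjE)
    assume "{c, d} = {w, w'}"
    then show ?thesis
      using that w'S by (auto simp: doubleton_eq_iff)
  next
    fix y assume y: "y \<in> J" "{c, d} = {w', y}"
    then have "c = y" "d = w'"
      using that w'S by (auto simp: doubleton_eq_iff)
    then show ?thesis
      using branch_unique[OF xN _ that(2), of y] branch_root y J x by blast
  next
    assume cd: "{c, d} \<in> ET" "\<forall>x\<in>J. {c, d} \<noteq> {w, x}"
    then show ?thesis
      using branch_crossing[OF xN cd(1)] that x(1) by (auto simp: insert_commute)
  qed
  then show ?thesis
    using x w'S branch_root
    by (intro exI[of _ x] exI[of _ w'] exI[of _ "branch VT ET w x"]) (auto simp: insert_commute)
next
  assume e: "e \<in> ET" "\<forall>x\<in>J. e \<noteq> {w, x}"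
  obtain a b where ab: "e = {a, b}" "a \<in> VT" "b \<in> VT" "a \<noteq> b"
    using edgeE[OF e(1)] .
  \<comment> \<open>Here \<open>w'\<close> is put on the side of \<open>w\<close>. The new edge then
    does not cross, and a moved edge crosses only if its original did, which would make the original
    equal to \<open>e\<close>.\<close>
  define S where "S = (if w \<in> branch VT ET b a then insert w' (branch VT ET b a) else branch VT ET b a)"
  have aN: "a \<in> nbrs ET b"
    using e(1) ab(1) by (simp add: nbrs_def insert_commute)
  have S_old: "c \<in> S \<longleftrightarrow> c \<in> branch VT ET b a" if "c \<noteq> w'" for c
    using that unfolding S_def by auto
  have S_w': "w' \<in> S \<longleftrightarrow> w \<in> S"
    using w' branch_subset[OF aN] w_neq_w' unfolding S_def by auto
  have old: "{c, d} = e" if "{c, d} \<in> ET" "c \<in> S" "d \<notin> S" for c d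
  proof -
    have "c \<noteq> w'" "d \<noteq> w'"
      using w'_notin_edge[OF that(1)] by auto
    then show ?thesis
      using branch_crossing[OF aN that(1)] that S_old ab by auto
  qed
  have "{c, d} = e" if "{c, d} \<in> split_edges ET w w' J" "c \<in> S" "d \<notin> S" for c d
    using that(1)[unfolded split_edges_iff]
  proof (elim disjE bexE conjE)
    assume "{c, d} = {w, w'}"
    then show ?thesis
      using that S_w' by (auto simp: doubleton_eq_iff)
  next
    fix y assume y: "y \<in> J" "{c, d} = {w', y}"
    then have yw: "{w, y} \<in> ET" "{y, w} \<in> ET"
      using J by (auto simp: nbrs_def insert_commute)
    have "y \<in> S \<longleftrightarrow> w' \<notin> S"
      using y that by (auto simp: doubleton_eq_iff)
    then have "{w, y} = e"
      using old[OF yw(1)] old[OF yw(2)] S_w' by (auto simp: insert_commute)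
    then show ?thesis
      using e(2) y(1) by blast
  qed (use old that in blast)
  moreover have "a \<noteq> w'" "b \<noteq> w'"
    using ab w' by auto
  then have "a \<in> S" "b \<notin> S"
    using branch_root branch_subset[OF aN] S_old by auto
  ultimately show ?thesis
    using ab by (intro exI[of _ a] exI[of _ b] exI[of _ S]) auto
qed

lemma split_tree: "is_tree (insert w' VT) (split_edges ET w w' J)"
  unfolding is_tree_def
proof (intro conjI ballI)
  show "\<exists>u v. e = {u, v} \<and> u \<in> insert w' VT \<and> v \<in> insert w' VT \<and> u \<noteq> v"
    if "e \<in> split_edges ET w w' J" for e
    using that[unfolded split_edges_iff]
  proof (elim disjE bexE conjE)
    assume "e = {w, w'}"
    then show ?thesis using w w_neq_w' by blast
  next
    fix x assume "x \<in> J" "e = {w', x}"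
    then show ?thesis using J_VT by blast
  next
    assume "e \<in> ET"
    then show ?thesis by (blast elim: edgeE)
  qed
  show "\<exists>xs. is_path (insert w' VT) (split_edges ET w w' J) xs \<and> hd xs = u \<and> last xs = v"
    if "u \<in> insert w' VT" "v \<in> insert w' VT" for u v
    using reach_in_imp_path[OF reach_in_trans[OF reach_adj_sym[OF reach_split] reach_split]] that
    by blast
  show "\<forall>xs. \<not> is_cycle (insert w' VT) (split_edges ET w w' J) xs"
    using acyclic_if_bridges[OF split_bridge] by blast
qed (use finite_VT in auto)

text \<open>Only the occurrence of \<open>w\<close> changes. It is replaced by the copy to which its
  neighbours on the path are attached, or by both copies in a row if these differ.\<close>

lemma split_path:
  assumes "is_path VT ET xs" "length xs \<ge> 2"
  shows "\<exists>xs'. is_path (insert w' VT) (split_edges ET w w' J) xs' \<and> length xs' \<ge> 2 \<and>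
    path_edges xs' = moved w w' J ` path_edges xs \<union> (if crosses ET w J xs then {{w, w'}} else {})"
proof -
  have xs: "set xs \<subseteq> VT" "path_edges xs \<subseteq> ET" "distinct xs"
    using assms(1) unfolding is_path_iff by auto
  have unmoved: "moved w w' J ` path_edges ys = path_edges ys" if "w \<notin> set ys" for ys
  proof -
    have "moved w w' J e = e" if "e \<in> path_edges ys" for e
      using moved_other[of e] path_edges_subset_set[OF that] \<open>w \<notin> set ys\<close> by blast
    then show ?thesis by simp
  qed
  obtain xs' where "distinct xs'" "set xs' \<subseteq> insert w' VT" "length xs' \<ge> 2"
    "path_edges xs' = moved w w' J ` path_edges xs \<union> (if crosses ET w J xs then {{w, w'}} else {})"
  proof (cases "w \<in> set xs")
    case False
    then have "\<not> crosses ET w J xs"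
      using path_edges_subset_set unfolding crosses_def by blast
    then show thesis
      using that[of xs] xs assms(2) unmoved[OF False] by auto
  next
    case True
    then obtain ys zs where dec: "xs = ys @ w # zs"
      by (meson split_list)
    have dist: "w \<notin> set ys" "w \<notin> set zs" "w' \<notin> set ys" "w' \<notin> set zs"
      using xs w' dec by auto
    \<comment> \<open>The copy of \<open>w\<close> to which the neighbour \<open>z\<close> is
      attached after the split.\<close>
    define att where "att z = (if z \<in> J then w' else w)" for z
    have moved_att: "moved w w' J {w, z} = {att z, z}" "moved w w' J {z, w} = {att z, z}" for z
    proof -
      show "moved w w' J {w, z} = {att z, z}"
        using moved_J[of z] moved_other[of "{w, z}"] unfolding att_def by (cases "z \<in> J") (auto simp: doubleton_eq_iff)
      then show "moved w w' J {z, w} = {att z, z}"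
        by (simp add: insert_commute)
    qed
    have pe: "moved w w' J ` path_edges xs = path_edges ys \<union> path_edges zs
        \<union> (if ys = [] then {} else {{last ys, att (last ys)}})
        \<union> (if zs = [] then {} else {{att (hd zs), hd zs}})"
      unfolding dec path_edges_split image_Un unmoved[OF dist(1)] unmoved[OF dist(2)]
      by (auto simp: moved_att insert_commute)
    have at: "{w, x} \<in> path_edges xs \<longleftrightarrow> ys \<noteq> [] \<and> x = last ys \<or> zs \<noteq> [] \<and> x = hd zs" for x
      using path_edges_at[of ys w zs x] xs(3) unfolding dec
      by (auto simp: path_edges_split insert_commute)
    have "x \<in> nbrs ET w" if "{w, x} \<in> path_edges xs" for x
      using that xs(2) unfolding nbrs_def by blast
    then have cr: "crosses ET w J xs \<longleftrightarrow> ys \<noteq> [] \<and> zs \<noteq> [] \<and> att (last ys) \<noteq> att (hd zs)"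
      using w_neq_w' unfolding crosses_def at att_def by auto
    consider "ys = []" "zs \<noteq> []" | "ys \<noteq> []" "zs = []" | "ys \<noteq> []" "zs \<noteq> []"
      using assms(2) dec by force
    then show thesis
    proof cases
      case 1
      let ?xs = "att (hd zs) # zs"
      have "att (hd zs) \<in> {w, w'}"
        by (simp add: att_def)
      then have "distinct ?xs" "set ?xs \<subseteq> insert w' VT"
        using xs dist w unfolding dec by auto
      moreover have "length ?xs \<ge> 2"
        using 1 by (cases zs) auto
      moreover have "path_edges ?xs = moved w w' J ` path_edges xs \<union>
          (if crosses ET w J xs then {{w, w'}} else {})"
        using 1 pe cr by (simp add: path_edges_Cons')
      ultimately show thesis
        by (rule that)
    next
      case 2
      let ?xs = "ys @ [att (last ys)]"
      have "att (last ys) \<in> {w, w'}"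
        by (simp add: att_def)
      then have "distinct ?xs" "set ?xs \<subseteq> insert w' VT"
        using xs dist w unfolding dec by auto
      moreover have "length ?xs \<ge> 2"
        using 2 by (cases ys) auto
      moreover have "path_edges ?xs = moved w w' J ` path_edges xs \<union>
          (if crosses ET w J xs then {{w, w'}} else {})"
        using 2 pe cr by (simp add: path_edges_append)
      ultimately show thesis
        by (rule that)
    next
      case 3
      show thesis
      proof (cases "att (last ys) = att (hd zs)")
        case True
        let ?xs = "ys @ att (hd zs) # zs"
        have "att (hd zs) \<in> {w, w'}"
          by (simp add: att_def)
        then have "distinct ?xs" "set ?xs \<subseteq> insert w' VT"
          using xs dist w unfolding dec by auto
        moreover have "length ?xs \<ge> 2"
          using 3 by (cases zs) auto
        moreover have "path_edges ?xs = moved w w' J ` path_edges xs \<union>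
            (if crosses ET w J xs then {{w, w'}} else {})"
          using 3 pe cr True by (simp add: path_edges_split)
        ultimately show thesis
          by (rule that)
      next
        case False
        then have eq: "{att (last ys), att (hd zs)} = {w, w'}"
          unfolding att_def by (auto split: if_splits)
        let ?xs = "ys @ att (last ys) # att (hd zs) # zs"
        have "att (hd zs) \<in> {w, w'}" "att (last ys) \<in> {w, w'}"
          using eq by auto
        then have "distinct ?xs" "set ?xs \<subseteq> insert w' VT"
          using xs dist w False unfolding dec by auto
        moreover have "length ?xs \<ge> 2"
          by simp
        moreover have "path_edges ?xs = moved w w' J ` path_edges xs \<union>
            (if crosses ET w J xs then {{w, w'}} else {})"
          using 3 pe cr False eq by (simp add: path_edges_split path_edges_Cons' insert_commute[of "{att (hd zs), hd zs}"])
        ultimately show thesis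
          by (rule that)
      qed
    qed
  qed
  then have "is_path (insert w' VT) (split_edges ET w w' J) xs' \<and> length xs' \<ge> 2 \<and>
    path_edges xs' = moved w w' J ` path_edges xs \<union> (if crosses ET w J xs then {{w, w'}} else {})"
    using xs(2) unfolding is_path_iff split_edges_def by auto
  then show ?thesis by blast
qed

end

text \<open>The new edge sets are the old ones under an injective map, plus the added edge for
  crossing paths. Hence intersections can only appear on the added edge, where \<open>share\<close>
  provides an old one, and a common edge of a Helly family is carried to a common edge.\<close>

lemma split_rep:
  assumes rep: "ept_rep V E VT ET P" and helly: "helly_rep V P"
    and "w \<in> VT" "w' \<notin> VT" "J \<subseteq> nbrs ET w"
    and share: "\<And>u v. \<lbrakk>u \<in> V; v \<in> V; crosses ET w J (P u); crosses ET w J (P v)\<rbrakk>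
      \<Longrightarrow> path_edges (P u) \<inter> path_edges (P v) \<noteq> {}"
  shows "\<exists>P'. ept_rep V E (insert w' VT) (split_edges ET w w' J) P' \<and> helly_rep V P'"
proof -
  interpret node_split VT ET w w' J
    using assms by unfold_locales (auto simp: ept_rep_def)
  let ?m = "moved w w' J"
  have "\<forall>v\<in>V. \<exists>xs. is_path (insert w' VT) (split_edges ET w w' J) xs \<and> length xs \<ge> 2 \<and>
      path_edges xs = ?m ` path_edges (P v) \<union> (if crosses ET w J (P v) then {{w, w'}} else {})"
    using rep split_path unfolding ept_rep_def by blast
  then obtain P' where P': "\<And>v. v \<in> V \<Longrightarrow> is_path (insert w' VT) (split_edges ET w w' J) (P' v)"
      "\<And>v. v \<in> V \<Longrightarrow> length (P' v) \<ge> 2"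
      "\<And>v. v \<in> V \<Longrightarrow> path_edges (P' v) =
        ?m ` path_edges (P v) \<union> (if crosses ET w J (P v) then {{w, w'}} else {})"
    by metis
  have sub: "path_edges (P v) \<subseteq> ET" if "v \<in> V" for v
    using rep that unfolding ept_rep_def is_path_iff by blast
  have meet: "path_edges (P' u) \<inter> path_edges (P' v) \<noteq> {} \<longleftrightarrow> path_edges (P u) \<inter> path_edges (P v) \<noteq> {}"
    if uv: "u \<in> V" "v \<in> V" for u v
  proof
    assume "path_edges (P u) \<inter> path_edges (P v) \<noteq> {}"
    then show "path_edges (P' u) \<inter> path_edges (P' v) \<noteq> {}"
      using P'(3) uv by blast
  next
    assume "path_edges (P' u) \<inter> path_edges (P' v) \<noteq> {}"
    then obtain e where e: "e \<in> path_edges (P' u)" "e \<in> path_edges (P' v)"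
      by blast
    show "path_edges (P u) \<inter> path_edges (P v) \<noteq> {}"
    proof (cases "e = {w, w'}")
      case True
      have "{w, w'} \<notin> ?m ` path_edges (P u)" "{w, w'} \<notin> ?m ` path_edges (P v)"
        using new_edge_not_moved sub uv by blast+
      then have "crosses ET w J (P u)" "crosses ET w J (P v)"
        using e P'(3) uv True by (auto split: if_splits)
      then show ?thesis
        using share uv by blast
    next
      case False
      then have "e \<in> ?m ` path_edges (P u)" "e \<in> ?m ` path_edges (P v)"
        using e P'(3) uv by (auto split: if_splits)
      then obtain f g where "f \<in> path_edges (P u)" "g \<in> path_edges (P v)" "?m f = ?m g"
        by auto
      then show ?thesis
        using inj_moved sub uv unfolding inj_on_def by blast
    qed
  qed
  have "helly_rep V P'"
    unfolding helly_rep_def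
  proof (intro allI impI, elim conjE)
    fix S assume S: "S \<subseteq> V" "S \<noteq> {}" "\<forall>v\<in>S. \<forall>w\<in>S. path_edges (P' v) \<inter> path_edges (P' w) \<noteq> {}"
    then have "\<forall>v\<in>S. \<forall>w\<in>S. path_edges (P v) \<inter> path_edges (P w) \<noteq> {}"
      using meet by blast
    then have "(\<Inter>v\<in>S. path_edges (P v)) \<noteq> {}"
      using helly S unfolding helly_rep_def by blast
    then obtain e where "\<And>v. v \<in> S \<Longrightarrow> e \<in> path_edges (P v)"
      by blast
    then have "?m e \<in> (\<Inter>v\<in>S. path_edges (P' v))"
      using P'(3) S(1) by blast
    then show "(\<Inter>v\<in>S. path_edges (P' v)) \<noteq> {}"
      by blast
  qed
  moreover have "ept_rep V E (insert w' VT) (split_edges ET w w' J) P'"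
    unfolding ept_rep_def
  proof (intro conjI ballI impI)
    fix u v assume "u \<in> V" "v \<in> V" "u \<noteq> v"
    moreover from this have "E u v \<longleftrightarrow> path_edges (P u) \<inter> path_edges (P v) \<noteq> {}"
      using rep unfolding ept_rep_def by blast
    ultimately show "E u v \<longleftrightarrow> path_edges (P' u) \<inter> path_edges (P' v) \<noteq> {}"
      using meet[of u v] by simp
  qed (use split_tree P'(1,2) in auto)
  ultimately show ?thesis by blast
qed

lemma degree_split:
  assumes "is_tree VT ET" "w \<in> VT" "w' \<notin> VT" "J \<subseteq> nbrs ET w"
  shows "degree (split_edges ET w w' J) w = Suc (card (nbrs ET w - J))"
    and "degree (split_edges ET w w' J) w' = Suc (card J)"
    and "z \<in> VT \<Longrightarrow> z \<noteq> w \<Longrightarrow> degree (split_edges ET w w' J) z = degree ET z"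
proof -
  interpret node_split VT ET w w' J
    using assms by unfold_locales
  interpret s: host_tree "insert w' VT" "split_edges ET w w' J"
    using split_tree by unfold_locales
  have w'_nbrs: "w' \<notin> nbrs ET x" for x
    using nbrs_subset w' by blast
  show "degree (split_edges ET w w' J) w = Suc (card (nbrs ET w - J))"
    using w'_nbrs finite_nbrs by (simp add: s.degree_eq nbrs_split_w)
  show "degree (split_edges ET w w' J) w' = Suc (card J)"
    using card_insert_disjoint[OF finite_subset[OF J finite_nbrs], of w] J_VT[of w]
    by (auto simp: s.degree_eq nbrs_split_w')
  assume z: "z \<in> VT" "z \<noteq> w"
  have "card (insert w' (nbrs ET z - {w})) = card (nbrs ET z)" if "z \<in> J"
  proof -
    have "w \<in> nbrs ET z"
      using that J by (auto simp: nbrs_def insert_commute)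
    then have "Suc (card (nbrs ET z - {w})) = card (nbrs ET z)"
      by (rule card_Suc_Diff1[OF finite_nbrs])
    moreover have "card (insert w' (nbrs ET z - {w})) = Suc (card (nbrs ET z - {w}))"
      using w'_nbrs finite_nbrs by (intro card_insert_disjoint) auto
    ultimately show ?thesis by simp
  qed
  then show "degree (split_edges ET w w' J) z = degree ET z"
    by (simp add: s.degree_eq degree_eq nbrs_split_other[OF z])
qed


section \<open>Cliques and atoms of finite graphs\<close>

lemma complete_in_extend:
  assumes "finite A" "complete_in A E D"
  obtains C where "is_clique A E C" "D \<subseteq> C"
proof -
  have "finite {C. complete_in A E C}"
    using assms(1) by (rule finite_subset[rotated, OF finite_Pow_iff[THEN iffD2]]) (auto simp: complete_in_def)
  from finite_has_maximal2[OF this, of D] assms(2) obtain C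
    where "complete_in A E C" "D \<subseteq> C" "\<forall>B. complete_in A E B \<longrightarrow> C \<subseteq> B \<longrightarrow> C = B"
    by auto
  then show thesis
    using that unfolding is_clique_def by blast
qed

lemma finite_cliques: "finite A \<Longrightarrow> finite (cliques A E)"
  by (rule finite_subset[of _ "Pow A"]) (auto simp: cliques_def is_clique_def complete_in_def)

text \<open>Extend each clique of the induced subgraph to a clique of the larger graph. Intersecting
  with \<open>A\<close> recovers the original by maximality, so the extension is injective.\<close>

lemma card_cliques_mono:
  assumes "A \<subseteq> B" "finite B"
  shows "card (cliques A E) \<le> card (cliques B E)"
proof -
  have "\<exists>D. is_clique B E D \<and> D \<inter> A = C" if "C \<in> cliques A E" for C
  proof -
    have C: "complete_in A E C" "\<And>D. complete_in A E D \<Longrightarrow> C \<subseteq> D \<Longrightarrow> D = C"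
      using that unfolding cliques_def is_clique_def by auto
    then have "complete_in B E C"
      using assms(1) unfolding complete_in_def by blast
    then obtain D where D: "is_clique B E D" "C \<subseteq> D"
      using complete_in_extend[OF assms(2)] by blast
    then have "D \<inter> A = C"
      using C unfolding is_clique_def complete_in_def by (intro C(2)) (auto simp: complete_in_def)
    then show ?thesis
      using D by blast
  qed
  then obtain g where g: "\<And>C. C \<in> cliques A E \<Longrightarrow> is_clique B E (g C) \<and> g C \<inter> A = C"
    by metis
  then have "inj_on g (cliques A E)"
    by (metis inj_onI)
  then show ?thesis
    using g finite_cliques[OF assms(2)] by (intro card_inj_on_le[of g]) (auto simp: cliques_def)
qed

lemma atom_exists:
  assumes "finite V" "A \<subseteq> V" "connected_in A E" "no_clique_separator A E"
  obtains B where "is_atom V E B" "A \<subseteq> B"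
proof -
  let ?F = "{B. B \<subseteq> V \<and> connected_in B E \<and> no_clique_separator B E}"
  have "finite ?F"
    using assms(1) by simp
  from finite_has_maximal2[OF this, of A] assms obtain B
    where "B \<in> ?F" "A \<subseteq> B" "\<forall>C\<in>?F. B \<subseteq> C \<longrightarrow> B = C"
    by blast
  then show thesis
    using that[of B] unfolding is_atom_def by blast
qed


section \<open>Helly representations\<close>

locale helly_host = host_tree +
  fixes V :: "'a set" and E :: "'a \<Rightarrow> 'a \<Rightarrow> bool" and P :: "'a \<Rightarrow> nat list"
  assumes graph: "simple_graph V E" and rep: "ept_rep V E VT ET P" and helly: "helly_rep V P"
begin

abbreviation pe :: "'a \<Rightarrow> nat set set" where
  "pe v \<equiv> path_edges (P v)"

lemma finite_V: "finite V" and E_V: "E u v \<Longrightarrow> u \<in> V \<and> v \<in> V \<and> u \<noteq> v"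
  using graph unfolding simple_graph_def by auto

lemma P_path: "v \<in> V \<Longrightarrow> is_path VT ET (P v)" and pe_subset: "v \<in> V \<Longrightarrow> pe v \<subseteq> ET"
    and pe_nonempty: "v \<in> V \<Longrightarrow> pe v \<noteq> {}"
  using rep path_edges_not_empty unfolding ept_rep_def is_path_iff by auto

lemma E_iff: "u \<in> V \<Longrightarrow> v \<in> V \<Longrightarrow> u \<noteq> v \<Longrightarrow> E u v \<longleftrightarrow> pe u \<inter> pe v \<noteq> {}"
  using rep unfolding ept_rep_def by blast

lemma complete_common_edge:
  assumes "A \<subseteq> V" "complete_in A E C" "C \<noteq> {}"
  obtains e where "e \<in> ET" "\<And>v. v \<in> C \<Longrightarrow> e \<in> pe v"
proof -
  have CV: "C \<subseteq> V"
    using assms unfolding complete_in_def by blast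
  have "pe v \<inter> pe u \<noteq> {}" if vu: "v \<in> C" "u \<in> C" for u v
  \<comment> \<open>The Helly premise also asks every path to meet itself, which holds because each
    path has an edge.\<close>
  proof (cases "u = v")
    case True
    then show ?thesis
      using vu CV pe_nonempty by blast
  next
    case False
    then have "E v u"
      using assms(2) vu unfolding complete_in_def by auto
    then show ?thesis
      using E_iff[of v u] False vu CV by auto
  qed
  then have "\<forall>v\<in>C. \<forall>u\<in>C. pe v \<inter> pe u \<noteq> {}"
    by blast
  then have "(\<Inter>v\<in>C. pe v) \<noteq> {}"
    using helly[unfolded helly_rep_def, THEN spec, of C] CV assms(3) by meson
  then obtain e where "\<And>v. v \<in> C \<Longrightarrow> e \<in> pe v"
    by blast
  then show thesis
    using that CV assms(3) pe_subset by blast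
qed

lemma carriers_complete: "A \<subseteq> V \<Longrightarrow> complete_in A E {v \<in> A. e \<in> pe v}"
  using E_iff unfolding complete_in_def by blast

lemma clique_nonempty:
  assumes "A \<noteq> {}" "is_clique A E C" shows "C \<noteq> {}"
proof
  assume C: "C = {}"
  obtain a where "a \<in> A"
    using assms(1) by blast
  then have "complete_in A E {a}"
    by (auto simp: complete_in_def)
  then show False
    using assms(2) C unfolding is_clique_def by blast
qed

text \<open>The members of a clique share an edge, and all paths through that edge form a complete
  set; maximality makes the two sets equal.\<close>

lemma clique_eq_carriers:
  assumes "A \<subseteq> V" "A \<noteq> {}" "is_clique A E C"
  shows "\<exists>e\<in>ET. C = {v \<in> A. e \<in> pe v}"
proof -
  have C: "complete_in A E C" "C \<noteq> {}"
    using assms clique_nonempty unfolding is_clique_def by auto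
  then obtain e where e: "e \<in> ET" "\<And>v. v \<in> C \<Longrightarrow> e \<in> pe v"
    using complete_common_edge[OF assms(1)] by metis
  then have "C \<subseteq> {v \<in> A. e \<in> pe v}"
    using C(1) unfolding complete_in_def by blast
  then show ?thesis
    using e(1) assms(3) carriers_complete[OF assms(1)] unfolding is_clique_def by metis
qed

text \<open>The node is the far end x of a directed edge w x with a smallest branch that meets two clique
  edges: by minimality the branches at x inside it meet at most one, and so does the branch back to
  w, since no edge has two clique edges on either side.\<close>

lemma card_cliques_le_degree:
  assumes AV: "A \<subseteq> V" and conn: "connected_in A E" and nosep: "no_clique_separator A E"
  obtains w where "w \<in> VT" "card (cliques A E) \<le> degree ET w"
proof -
  define F where "F e = {v \<in> A. e \<in> pe v}" for e
  have Ane: "A \<noteq> {}"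
    using conn unfolding connected_in_def by blast
  have finA: "finite A"
    using AV finite_V finite_subset by blast
  have "\<exists>e\<in>ET. C = F e" if "C \<in> cliques A E" for C
    using that clique_eq_carriers[OF AV Ane] unfolding cliques_def F_def by blast
  \<comment> \<open>One tree edge is chosen for each clique, so the set \<open>K\<close> of chosen
    edges has as many elements as there are cliques.\<close>
  then obtain c where c: "\<And>C. C \<in> cliques A E \<Longrightarrow> c C \<in> ET" "\<And>C. C \<in> cliques A E \<Longrightarrow> F (c C) = C"
    by metis
  define K where "K = c ` cliques A E"
  have finK: "finite K"
    unfolding K_def using finite_cliques[OF finA] by blast
  have "inj_on c (cliques A E)"
    using c(2) by (metis inj_onI)
  then have cardK: "card K = card (cliques A E)"
    unfolding K_def by (rule card_image)
  have KE: "e \<in> ET" "is_clique A E (F e)" if "e \<in> K" for e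
    using that c unfolding K_def cliques_def by auto
  have K_incomparable: "\<exists>v. v \<in> F f \<and> v \<notin> F e" if "e \<in> K" "f \<in> K" "f \<noteq> e" for e f
  proof (rule ccontr)
    assume "\<nexists>v. v \<in> F f \<and> v \<notin> F e"
    then have "F e = F f"
      using KE that unfolding is_clique_def by blast
    then show False
      using that c(2) unfolding K_def by auto
  qed
  \<comment> \<open>Deleting \<open>F e\<close> removes every path that uses \<open>{w, x}\<close>,
    so a remaining path that meets the branch lies inside it, and so do its remaining neighbours.
    Thus \<open>F e\<close> separates a vertex of \<open>F f\<close> from one of
    \<open>F g\<close>.\<close>
  have separated: False
    if x: "x \<in> nbrs ET w" and efg: "e \<in> K" "f \<in> K" "g \<in> K" "f \<noteq> e" "g \<noteq> e"
      and sub: "F {w, x} \<subseteq> F e" and f: "f \<inter> branch VT ET w x \<noteq> {}" and g: "g \<inter> branch VT ET x w \<noteq> {}"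
    for w x e f g
  proof -
    obtain v where v: "v \<in> F f" "v \<notin> F e"
      using K_incomparable efg by blast
    obtain u where u: "u \<in> F g" "u \<notin> F e"
      using K_incomparable efg by blast
    have "\<not> disconnected_in (A - F e) E"
      using nosep KE(2)[OF efg(1)] unfolding no_clique_separator_def clique_separator_def by blast
    then have vu: "reach_in (A - F e) E v u"
      using u v unfolding disconnected_in_def F_def by blast
    have side: "set (P z) \<subseteq> branch VT ET w x"
      if z: "z \<in> A" "z \<notin> F e" "set (P z) \<inter> branch VT ET w x \<noteq> {}" for z
    proof (rule ccontr)
      assume "\<not> set (P z) \<subseteq> branch VT ET w x"
      then have "{w, x} \<in> pe z"
        using z branch_path_edge[OF P_path x, of z] AV by blast
      then show False
        using z sub unfolding F_def by blast
    qed
    define S where "S = {z. set (P z) \<subseteq> branch VT ET w x}"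
    have "f \<subseteq> set (P v)" "v \<in> A"
      using v path_edges_subset_set unfolding F_def by blast+
    then have "v \<in> S"
      using f v side[of v] unfolding S_def by blast
    with vu have "u \<in> S"
    proof (rule reach_in_closed)
      fix a b assume ab: "a \<in> A - F e" "b \<in> A - F e" "E a b" "a \<in> S"
      then obtain k where k: "k \<in> pe a" "k \<in> pe b"
        using E_iff[of a b] E_V by blast
      then have "k \<subseteq> set (P a)" "k \<subseteq> set (P b)" "k \<noteq> {}"
        using path_edges_subset_set pe_subset[of a] ab AV by (blast elim: edgeE)+
      then have "set (P b) \<inter> branch VT ET w x \<noteq> {}"
        using ab(4) unfolding S_def by blast
      then show "b \<in> S"
        using side ab(2) unfolding S_def by blast
    qed
    moreover have "g \<subseteq> set (P u)"
      using u path_edges_subset_set unfolding F_def by blast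
    ultimately show False
      using g branch_disjoint[OF x] unfolding S_def by blast
  qed
  \<comment> \<open>Meeting the branch suffices, so the edge \<open>{w, x}\<close> itself counts as
    touched from both of its sides if it lies in \<open>K\<close>.\<close>
  define touch where "touch w x = {e \<in> K. e \<inter> branch VT ET w x \<noteq> {}}" for w x
  have avoid: "\<exists>f\<in>touch w x. f \<noteq> e" if "card (touch w x) \<ge> 2" for w x e
  proof (rule ccontr)
    assume "\<not> ?thesis"
    then have "touch w x \<subseteq> {e}" by blast
    then have "card (touch w x) \<le> card {e}"
      by (intro card_mono) auto
    then show False using that by simp
  qed
  have "\<exists>w\<in>VT. \<forall>x\<in>nbrs ET w. card (touch w x) \<le> 1"
  proof (cases "\<exists>p. snd p \<in> nbrs ET (fst p) \<and> card (touch (fst p) (snd p)) \<ge> 2")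
    case False
    then have "\<forall>x\<in>nbrs ET w. card (touch w x) \<le> 1" for w
      by (metis fst_conv not_less_eq_eq numeral_2_eq_2 One_nat_def snd_conv)
    then show ?thesis
      using VT_nonempty by blast
  next
    case True
    then obtain p where p: "snd p \<in> nbrs ET (fst p)" "card (touch (fst p) (snd p)) \<ge> 2"
      and least: "\<And>q. snd q \<in> nbrs ET (fst q) \<and> card (touch (fst q) (snd q)) \<ge> 2 \<Longrightarrow>
          card (branch VT ET (fst p) (snd p)) \<le> card (branch VT ET (fst q) (snd q))"
      using ex_has_least_nat[of "\<lambda>p. snd p \<in> nbrs ET (fst p) \<and> card (touch (fst p) (snd p)) \<ge> 2" _
          "\<lambda>p. card (branch VT ET (fst p) (snd p))"] by blast
    obtain w x where wx: "p = (w, x)"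
      by (cases p)
    have x: "x \<in> nbrs ET w" and two: "card (touch w x) \<ge> 2"
      using p wx by auto
    have "card (touch x y) \<le> 1" if y: "y \<in> nbrs ET x" for y
    proof (rule ccontr)
      assume "\<not> card (touch x y) \<le> 1"
      then have y2: "card (touch x y) \<ge> 2" by simp
      show False
      proof (cases "y = w")
        case True
        \<comment> \<open>The paths through \<open>{w, x}\<close> form a complete set that need not
          be maximal, so the separating clique is an extension of it. Two touched edges on either
          side leave one different from \<open>e\<close> on each.\<close>
        obtain C where "is_clique A E C" "F {w, x} \<subseteq> C"
          using complete_in_extend[OF finA carriers_complete[OF AV, of "{w, x}"]] unfolding F_def by blast
        then obtain e where e: "e \<in> K" "F {w, x} \<subseteq> F e"
          using c(2) unfolding K_def cliques_def by blast
        obtain f g where "f \<in> touch w x" "f \<noteq> e" "g \<in> touch x w" "g \<noteq> e"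
          using avoid[OF two, of e] avoid[OF y2, of e] unfolding True by auto
        then show False
          using separated[OF x, of e f g] e unfolding touch_def by blast
      next
        case False
        have "finite (branch VT ET w x)"
          using branch_subset[OF x] finite_VT finite_subset by blast
        then have "card (branch VT ET x y) < card (branch VT ET w x)"
          using branch_nested[OF x y False] by (rule psubset_card_mono)
        then show False
          using least[of "(x, y)"] y y2 wx by simp
      qed
    qed
    then show ?thesis
      using x nbrs_subset by blast
  qed
  then obtain w where w: "w \<in> VT" "\<And>x. x \<in> nbrs ET w \<Longrightarrow> card (touch w x) \<le> 1"
    by blast
  \<comment> \<open>Every clique edge has an endpoint other than \<open>w\<close>, hence touches a
    branch at \<open>w\<close>; with at most one per branch, the degree bounds their number.\<close>
  have "K \<subseteq> (\<Union>x\<in>nbrs ET w. touch w x)"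
  proof
    fix e assume e: "e \<in> K"
    then obtain a b where "e = {a, b}" "a \<in> VT" "b \<in> VT" "a \<noteq> b"
      using edgeE[OF KE(1)] by metis
    then obtain y where "y \<in> e" "y \<in> VT" "y \<noteq> w"
      by blast
    moreover from this obtain x where "x \<in> nbrs ET w" "y \<in> branch VT ET w x"
      using in_some_branch[OF w(1)] by metis
    ultimately show "e \<in> (\<Union>x\<in>nbrs ET w. touch w x)"
      using e unfolding touch_def by blast
  qed
  then have "card K \<le> card (\<Union>x\<in>nbrs ET w. touch w x)"
    using finite_nbrs finK by (intro card_mono) (auto simp: touch_def)
  also have "\<dots> \<le> (\<Sum>x\<in>nbrs ET w. card (touch w x))"
    by (rule card_UN_le[OF finite_nbrs])
  also have "\<dots> \<le> (\<Sum>x\<in>nbrs ET w. 1)"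
    by (rule sum_mono) (rule w(2))
  finally have "card K \<le> degree ET w"
    by (simp add: degree_eq)
  then show thesis
    using that w(1) cardK by simp
qed

end


section \<open>The link of a node\<close>

definition ends_at :: "('a \<Rightarrow> nat list) \<Rightarrow> nat \<Rightarrow> 'a \<Rightarrow> nat set" where
  "ends_at P w v = {x. {w, x} \<in> path_edges (P v)}"

definition link :: "'a set \<Rightarrow> ('a \<Rightarrow> nat list) \<Rightarrow> nat \<Rightarrow> nat \<Rightarrow> nat \<Rightarrow> bool" where
  "link V P w x y \<longleftrightarrow> x \<noteq> y \<and> (\<exists>v\<in>V. x \<in> ends_at P w v \<and> y \<in> ends_at P w v)"

text \<open>Requiring two distinct ends leaves out the paths that stop at \<open>w\<close>, so the
  members correspond to edges of the link.\<close>

definition through :: "'a set \<Rightarrow> ('a \<Rightarrow> nat list) \<Rightarrow> nat \<Rightarrow> 'a set" where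
  "through V P w = {v \<in> V. \<exists>x y. x \<noteq> y \<and> x \<in> ends_at P w v \<and> y \<in> ends_at P w v}"

context helly_host
begin

context
  fixes w :: nat
  assumes w: "w \<in> VT"
begin

abbreviation "ends \<equiv> ends_at P w"
abbreviation "A0 \<equiv> through V P w"
abbreviation "N \<equiv> nbrs ET w"
abbreviation "L \<equiv> link V P w"

lemma ends_subset: "v \<in> V \<Longrightarrow> ends v \<subseteq> N"
  using pe_subset unfolding ends_at_def nbrs_def by blast

lemma A0_V: "A0 \<subseteq> V"
  unfolding through_def by blast

lemma ends_eq:
  assumes "v \<in> V" "x \<in> ends v" "y \<in> ends v" "x \<noteq> y"
  shows "ends v = {x, y}"
  using assms path_edges_at_most_two P_path[OF assms(1)] unfolding ends_at_def is_path_iff by blast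

lemma link_through:
  assumes "L x y"
  obtains v where "v \<in> A0" "ends v = {x, y}" "x \<noteq> y"
  using assms ends_eq unfolding link_def through_def by blast

lemma E_if_common_end: "u \<in> V \<Longrightarrow> v \<in> V \<Longrightarrow> u \<noteq> v \<Longrightarrow> x \<in> ends u \<Longrightarrow> x \<in> ends v \<Longrightarrow> E u v"
  using E_iff unfolding ends_at_def by blast

text \<open>A common edge of paths through w lies in one branch at w, and all these paths enter that
  branch by its first edge.\<close>

lemma complete_common_end:
  assumes "complete_in A0 E C" "C \<noteq> {}"
  obtains x where "x \<in> N" "\<And>v. v \<in> C \<Longrightarrow> x \<in> ends v"
proof -
  obtain e where e: "e \<in> ET" "\<And>v. v \<in> C \<Longrightarrow> e \<in> pe v"
    using complete_common_edge[OF A0_V assms] by blast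
  obtain a b where "e = {a, b}" "a \<in> VT" "b \<in> VT" "a \<noteq> b"
    using edgeE[OF e(1)] .
  then obtain y where y: "y \<in> e" "y \<in> VT" "y \<noteq> w"
    by blast
  then obtain x where x: "x \<in> N" "y \<in> branch VT ET w x"
    using in_some_branch[OF w] by metis
  have "x \<in> ends v" if "v \<in> C" for v
  proof -
    have v: "v \<in> V" "v \<in> A0"
      using that assms(1) A0_V unfolding complete_in_def by blast+
    have "w \<in> set (P v)"
      using v(2) path_edges_subset_set unfolding through_def ends_at_def by blast
    moreover have "y \<in> set (P v)"
      using e(2)[OF that] y(1) path_edges_subset_set by blast
    moreover have "w \<notin> branch VT ET w x"
      using branch_subset[OF x(1)] by blast
    ultimately show ?thesis
      using branch_path_edge[OF P_path[OF v(1)] x(1)] x(2) unfolding ends_at_def by blast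
  qed
  then show thesis
    using that x(1) by blast
qed

text \<open>Each step of a link walk is carried by a path with these two ends, and consecutive
  carriers share an end and are hence equal or adjacent. Restricting the ends to \<open>M\<close>
  lets the deletion of a link vertex match the deletion of its star.\<close>

lemma link_reach_imp_reach:
  assumes "reach_in M L x y" "u \<in> A0" "ends u \<subseteq> M" "x \<in> ends u" "v \<in> A0" "ends v \<subseteq> M" "y \<in> ends v"
  shows "reach_in {v \<in> A0. ends v \<subseteq> M} E u v"
proof -
  let ?R = "reach_in {v \<in> A0. ends v \<subseteq> M} E"
  have step: "?R a b" if "a \<in> A0" "b \<in> A0" "ends a \<subseteq> M" "ends b \<subseteq> M" "z \<in> ends a" "z \<in> ends b" for a b z
  proof (cases "a = b")
    case False
    then have "E a b"
      using that E_if_common_end[of a b z] A0_V by blast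
    then show ?thesis
      using that by (intro reach_in_edge) auto
  qed (simp add: reach_in_refl)
  \<comment> \<open>The invariant covers all admissible paths ending at the current link vertex, so
    the choice of carrier for the next step is free.\<close>
  have "y \<in> {y. \<forall>v\<in>A0. ends v \<subseteq> M \<longrightarrow> y \<in> ends v \<longrightarrow> ?R u v}"
    using assms(1)
  proof (rule reach_in_closed)
    show "x \<in> {y. \<forall>v\<in>A0. ends v \<subseteq> M \<longrightarrow> y \<in> ends v \<longrightarrow> ?R u v}"
      using step assms by blast
    fix a b assume ab: "a \<in> M" "b \<in> M" "L a b"
      and a: "a \<in> {y. \<forall>v\<in>A0. ends v \<subseteq> M \<longrightarrow> y \<in> ends v \<longrightarrow> ?R u v}"
    obtain k where k: "k \<in> A0" "ends k = {a, b}"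
      using link_through[OF ab(3)] by metis
    then have "ends k \<subseteq> M" "a \<in> ends k"
      using ab by auto
    then have uk: "?R u k"
      using a k(1) by blast
    have "?R u v" if v: "v \<in> A0" "ends v \<subseteq> M" "b \<in> ends v" for v
    proof -
      have "?R k v"
        using k v ab by (intro step[of k v b]) auto
      with uk show ?thesis
        by (rule reach_in_trans)
    qed
    then show "b \<in> {y. \<forall>v\<in>A0. ends v \<subseteq> M \<longrightarrow> y \<in> ends v \<longrightarrow> ?R u v}"
      by blast
  qed
  then show ?thesis
    using assms by blast
qed

text \<open>The stars \<open>St x\<close> are pairwise incomparable, since each contains two paths
  whose only common end is \<open>x\<close>. They are therefore distinct cliques, and every clique
  is one of them, so a clique separator would yield a cut vertex of the link.\<close>

lemma through_atomic:
  assumes N3: "card N \<ge> 3" and conn: "\<And>i. i \<in> N \<Longrightarrow> \<not> disconnected_in (N - {i}) L"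
  shows "connected_in A0 E" "no_clique_separator A0 E" "card N \<le> card (cliques A0 E)"
proof -
  have third: "\<exists>t\<in>N. t \<noteq> x \<and> t \<noteq> y" for x y
  proof (rule ccontr)
    assume "\<not> ?thesis"
    then have "N \<subseteq> {x, y}" by blast
    then have "card N \<le> card {x, y}"
      by (intro card_mono) auto
    then show False
      using N3 card_insert_le_m1[of 2 "{y}" x] by auto
  qed
  \<comment> \<open>A walk from \<open>x\<close> to a third vertex inside the link minus
    \<open>i\<close> starts with a step to a neighbour other than \<open>i\<close>.\<close>
  have neighbour: "\<exists>y. L x y \<and> y \<noteq> i" if "x \<in> N" "i \<in> N" "x \<noteq> i" for x i
  proof -
    obtain t where t: "t \<in> N" "t \<noteq> x" "t \<noteq> i"
      using third by blast
    then have "reach_in (N - {i}) L x t"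
      using conn[OF that(2)] that unfolding disconnected_in_def by blast
    then show ?thesis
      using t(2) unfolding reach_in_def by (cases rule: converse_rtranclpE) auto
  qed
  define St where "St x = {v \<in> A0. x \<in> ends v}" for x
  have two: "\<exists>u v y z. u \<in> St x \<and> v \<in> St x \<and> ends u = {x, y} \<and> ends v = {x, z} \<and> y \<noteq> z"
    if x: "x \<in> N" for x
  proof -
    obtain i where "i \<in> N" "i \<noteq> x"
      using third by blast
    then obtain y where y: "L x y"
      using neighbour x by blast
    obtain u where u: "u \<in> A0" "ends u = {x, y}" "x \<noteq> y"
      using link_through[OF y] .
    have "y \<in> N"
      using u ends_subset A0_V by blast
    then obtain z where z: "L x z" "z \<noteq> y"
      using neighbour[OF x] u(3) by blast
    obtain v where v: "v \<in> A0" "ends v = {x, z}"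
      using link_through[OF z(1)] .
    show ?thesis
      using u v z unfolding St_def by blast
  qed
  have St_complete: "complete_in A0 E (St x)" for x
    using E_if_common_end A0_V unfolding complete_in_def St_def by blast
  have St_unique: "x = x'" if St: "x \<in> N" "St x \<subseteq> St x'" for x x'
  proof -
    obtain u v y z where "u \<in> St x" "v \<in> St x" "ends u = {x, y}" "ends v = {x, z}" "y \<noteq> z"
      using two[OF St(1)] by blast
    moreover from this St(2) have "x' \<in> ends u" "x' \<in> ends v"
      unfolding St_def by auto
    ultimately show ?thesis by auto
  qed
  have in_St: "\<exists>x\<in>N. C \<subseteq> St x" if C: "complete_in A0 E C" "C \<noteq> {}" for C
  proof -
    obtain x where "x \<in> N" "\<And>v. v \<in> C \<Longrightarrow> x \<in> ends v"
      using complete_common_end[OF C] by blast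
    then show ?thesis
      using C(1) unfolding St_def complete_in_def by blast
  qed
  have St_clique: "is_clique A0 E (St x)" if x: "x \<in> N" for x
    unfolding is_clique_def
  proof (intro conjI allI impI, rule St_complete, elim conjE)
    fix D assume D: "complete_in A0 E D" "St x \<subseteq> D"
    have "D \<noteq> {}"
      using two[OF x] D(2) by blast
    then obtain x' where "x' \<in> N" "D \<subseteq> St x'"
      using in_St D by blast
    then show "D = St x"
      using St_unique[OF x, of x'] D(2) by blast
  qed
  have "inj_on St N"
    by (rule inj_onI) (use St_unique in auto)
  then show "card N \<le> card (cliques A0 E)"
    using St_clique finite_cliques[of A0] finite_subset[OF A0_V finite_V]
    by (intro card_inj_on_le[of St]) (auto simp: cliques_def)
  have all: "{v \<in> A0. ends v \<subseteq> N} = A0"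
    using ends_subset A0_V by blast
  have A0_ne: "A0 \<noteq> {}"
    using third two unfolding St_def by blast
  show "connected_in A0 E"
    unfolding connected_in_def
  proof (intro conjI ballI, rule A0_ne)
    fix u v assume uv: "u \<in> A0" "v \<in> A0"
    then obtain x y where xy: "x \<in> ends u" "y \<in> ends v"
      unfolding through_def by blast
    have xyN: "x \<in> N" "y \<in> N"
      using xy uv ends_subset A0_V by blast+
    obtain i where "i \<in> N" "i \<noteq> x" "i \<noteq> y"
      using third by blast
    then have "reach_in (N - {i}) L x y"
      using conn xyN unfolding disconnected_in_def by blast
    then have "reach_in N L x y"
      by (rule reach_in_mono[rotated]) blast
    then show "reach_in A0 E u v"
      using link_reach_imp_reach[of N x y u v] uv xy ends_subset A0_V all by auto
  qed
  show "no_clique_separator A0 E"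
    unfolding no_clique_separator_def
  proof (intro allI notI)
    fix C assume "clique_separator A0 E C"
    then have C: "is_clique A0 E C" "disconnected_in (A0 - C) E"
      unfolding clique_separator_def by auto
    then obtain i where i: "i \<in> N" "C \<subseteq> St i"
      using in_St clique_nonempty[OF A0_ne] unfolding is_clique_def by metis
    then have "C = St i"
      using C(1) St_complete unfolding is_clique_def by blast
    \<comment> \<open>Removing the star of \<open>i\<close> leaves the paths whose ends avoid
      \<open>i\<close>, which is the form needed to transfer walks of the reduced link.\<close>
    then have eq: "A0 - C = {v \<in> A0. ends v \<subseteq> N - {i}}"
      using ends_subset A0_V unfolding St_def by blast
    have "reach_in (A0 - C) E u v" if "u \<in> A0 - C" "v \<in> A0 - C" for u v
    proof -
      have uv: "u \<in> A0" "v \<in> A0" "ends u \<subseteq> N - {i}" "ends v \<subseteq> N - {i}"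
        using that unfolding eq by auto
      then obtain x y where xy: "x \<in> ends u" "y \<in> ends v"
        unfolding through_def by blast
      then have "reach_in (N - {i}) L x y"
        using conn[OF i(1)] uv unfolding disconnected_in_def by blast
      then show ?thesis
        using link_reach_imp_reach uv xy unfolding eq by blast
    qed
    then show False
      using C(2) unfolding disconnected_in_def by blast
  qed
qed

text \<open>No link edge leaves a component \<open>K\<close> of the link minus \<open>i\<close>
  except towards \<open>i\<close>. Hence both \<open>K\<close> and \<open>insert i K\<close> have
  the crossing property, and the freedom to place \<open>i\<close> on either side keeps both parts
  at size 2 or more.\<close>

lemma link_cut:
  assumes N4: "card N \<ge> 4" and i: "i \<in> N" and disc: "disconnected_in (N - {i}) L"
  obtains J where "J \<subseteq> N" "2 \<le> card J" "2 \<le> card (N - J)"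
    "\<And>v. v \<in> V \<Longrightarrow> crosses ET w J (P v) \<Longrightarrow> {w, i} \<in> pe v"
proof -
  obtain a b where ab: "a \<in> N - {i}" "b \<in> N - {i}" "\<not> reach_in (N - {i}) L a b"
    using disc unfolding disconnected_in_def by blast
  define K where "K = {y. reach_in (N - {i}) L a y}"
  have KN: "K \<subseteq> N - {i}"
  proof
    fix y assume "y \<in> K"
    then have "reach_in (N - {i}) L a y"
      by (simp add: K_def)
    then show "y \<in> N - {i}"
      by (rule reach_in_closed) (use ab in auto)
  qed
  have aK: "a \<in> K" and bK: "b \<notin> K"
    using ab(3) by (auto simp: K_def reach_in_refl)
  have K_closed: "y \<in> K" if "x \<in> K" "L x y" "y \<in> N - {i}" for x y
  proof -
    have "reach_in (N - {i}) L x y"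
      using that KN by (intro reach_in_edge) auto
    then show ?thesis
      using that(1) unfolding K_def by (auto intro: reach_in_trans)
  qed
  have linked: "L x y" if "v \<in> V" "{w, x} \<in> pe v" "{w, y} \<in> pe v" "x \<noteq> y" for v x y
    using that unfolding link_def ends_at_def by blast
  have finK: "finite K"
    using KN finite_nbrs finite_subset by blast
  show thesis
  proof (cases "card K \<ge> 2")
    case True
    show thesis
    proof (rule that[of K])
      have "card {i, b} \<le> card (N - K)"
        using ab i bK KN finite_nbrs by (intro card_mono) auto
      then show "2 \<le> card (N - K)"
        using ab by auto
      fix v assume v: "v \<in> V" "crosses ET w K (P v)"
      then obtain x y where "x \<in> K" "y \<in> N - K" "{w, x} \<in> pe v" "{w, y} \<in> pe v"
        unfolding crosses_def by blast
      then show "{w, i} \<in> pe v"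
        using linked[OF v(1)] K_closed[of x y] by blast
    qed (use KN True in auto)
  next
    case False
    \<comment> \<open>Here \<open>K\<close> is the singleton of \<open>a\<close>, so
      \<open>i\<close> joins it; the other part keeps at least two of the four or more
      neighbours.\<close>
    show thesis
    proof (rule that[of "insert i K"])
      have "card {i, a} \<le> card (insert i K)"
        using aK finK by (intro card_mono) auto
      then show "2 \<le> card (insert i K)"
        using ab by auto
      have "card (insert i K) \<le> 2"
        using False finK card_insert_le_m1[of 2 K i] by simp
      moreover have "card (N - insert i K) = card N - card (insert i K)"
        using i KN finK by (intro card_Diff_subset) auto
      ultimately show "2 \<le> card (N - insert i K)"
        using N4 by simp
      fix v assume v: "v \<in> V" "crosses ET w (insert i K) (P v)"
      then obtain x y where "x \<in> insert i K" "y \<in> N - insert i K" "{w, x} \<in> pe v" "{w, y} \<in> pe v"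
        unfolding crosses_def by blast
      then show "{w, i} \<in> pe v"
        using linked[OF v(1)] K_closed[of x y] by blast
    qed (use KN i in auto)
  qed
qed

text \<open>If no deletion disconnects the link, the paths through \<open>w\<close> lie in an atom
  with too many cliques. Otherwise a split lowers the weight:
  \<open>3 ^ (a + 1) + 3 ^ (b + 1) < 3 ^ (a + b)\<close> for a and b at least 2. Base 2 would give
  equality at a = b = 2.\<close>

lemma degree_reduction:
  assumes N4: "card N \<ge> 4" and atoms: "\<And>A. is_atom V E A \<Longrightarrow> card (cliques A E) < card N"
  obtains VT' ET' P' where "ept_rep V E VT' ET' P'" "helly_rep V P'"
    "(\<Sum>z\<in>VT'. 3 ^ degree ET' z) < (\<Sum>z\<in>VT. 3 ^ degree ET z :: nat)"
proof (cases "\<exists>i\<in>N. disconnected_in (N - {i}) L")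
  case False
  then have *: "connected_in A0 E" "no_clique_separator A0 E" "card N \<le> card (cliques A0 E)"
    using through_atomic N4 by auto
  obtain B where "is_atom V E B" "A0 \<subseteq> B"
    using atom_exists[OF finite_V A0_V *(1,2)] .
  moreover from this have "card (cliques A0 E) \<le> card (cliques B E)"
    using finite_V finite_subset unfolding is_atom_def by (metis card_cliques_mono)
  ultimately show thesis
    using atoms[of B] *(3) by linarith
next
  case True
  then obtain i where i: "i \<in> N" "disconnected_in (N - {i}) L"
    by blast
  obtain J where J: "J \<subseteq> N" "2 \<le> card J" "2 \<le> card (N - J)"
      "\<And>v. v \<in> V \<Longrightarrow> crosses ET w J (P v) \<Longrightarrow> {w, i} \<in> pe v"
    using link_cut[OF N4 i] by blast
  obtain w' where w': "w' \<notin> VT"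
    using finite_VT ex_new_if_finite infinite_UNIV_nat by blast
  let ?ET = "split_edges ET w w' J"
  obtain P' where P': "ept_rep V E (insert w' VT) ?ET P'" "helly_rep V P'"
    using split_rep[OF rep helly w w' J(1)] J(4) by blast
  note deg = degree_split[OF tree w w' J(1)]
  let ?a = "card J" and ?b = "card (N - J)"
  have N: "card N = ?a + ?b"
    using J(1) finite_nbrs by (metis card_Diff_subset card_mono finite_subset le_add_diff_inverse)
  obtain a b where ab: "?a = a + 2" "?b = b + 2"
    using J(2,3) by (metis le_add_diff_inverse2)
  \<comment> \<open>With the exponents shifted by 2 and X the product of the two powers, the new
    weight is at most 54 X and the old one is 81 X.\<close>
  have "(3::nat) ^ b \<le> 3 ^ a * 3 ^ b" "(3::nat) ^ a \<le> 3 ^ a * 3 ^ b" "0 < (3::nat) ^ a * 3 ^ b"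
    by simp_all
  moreover have "(3::nat) ^ Suc ?a = 27 * 3 ^ a" "(3::nat) ^ Suc ?b = 27 * 3 ^ b"
      "(3::nat) ^ card N = 81 * (3 ^ a * 3 ^ b)"
    unfolding N ab by (simp_all add: power_add)
  ultimately have less: "(3::nat) ^ Suc ?a + 3 ^ Suc ?b < 3 ^ card N"
    by linarith
  have rest: "(\<Sum>z\<in>VT - {w}. 3 ^ degree ?ET z) = (\<Sum>z\<in>VT - {w}. 3 ^ degree ET z :: nat)"
    using deg(3) by (intro sum.cong) auto
  have "(\<Sum>z\<in>insert w' VT. 3 ^ degree ?ET z) =
      3 ^ Suc ?a + (3 ^ Suc ?b + (\<Sum>z\<in>VT - {w}. 3 ^ degree ET z) :: nat)"
    using finite_VT w w' deg(1,2) rest by (simp add: sum.remove[of VT w])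
  also have "\<dots> < 3 ^ card N + (\<Sum>z\<in>VT - {w}. 3 ^ degree ET z)"
    using less by simp
  also have "\<dots> = (\<Sum>z\<in>VT. 3 ^ degree ET z)"
    using finite_VT w by (simp add: sum.remove[of VT w] degree_eq)
  finally show thesis
    using that P' by blast
qed

end

end

section \<open>Repeated splitting and adjustment of the maximum degree\<close>

lemma bounded_degree_rep:
  assumes "simple_graph V E" "h \<ge> 3" "\<And>A. is_atom V E A \<Longrightarrow> card (cliques A E) \<le> h"
  shows "ept_rep V E VT ET P \<Longrightarrow> helly_rep V P \<Longrightarrow>
    \<exists>VT ET P. ept_rep V E VT ET P \<and> helly_rep V P \<and> (\<forall>z\<in>VT. degree ET z \<le> h)"
proof (induction "\<Sum>z\<in>VT. 3 ^ degree ET z :: nat" arbitrary: VT ET P rule: less_induct)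
  case less
  interpret helly_host VT ET V E P
    using less.prems assms(1) by unfold_locales (auto simp: ept_rep_def)
  show ?case
  proof (cases "\<forall>z\<in>VT. degree ET z \<le> h")
    case True
    then show ?thesis
      using less.prems by blast
  next
    case False
    then obtain w where w: "w \<in> VT" "h < card (nbrs ET w)"
      by (auto simp: degree_eq not_le)
    have "card (cliques A E) < card (nbrs ET w)" if "is_atom V E A" for A
      using assms(3)[OF that] w(2) by simp
    moreover have "4 \<le> card (nbrs ET w)"
      using w(2) assms(2) by simp
    ultimately obtain VT' ET' P' where "ept_rep V E VT' ET' P'" "helly_rep V P'"
        "(\<Sum>z\<in>VT'. 3 ^ degree ET' z) < (\<Sum>z\<in>VT. 3 ^ degree ET z :: nat)"
      using degree_reduction[OF w(1)] by metis
    then show ?thesis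
      using less.hyps by blast
  qed
qed

text \<open>Splitting off the empty set hangs a leaf on \<open>w\<close>. No path crosses, so the
  represented graph is unchanged, the degree of \<open>w\<close> grows by one, and the leaf has
  degree 1, which is within the bound as \<open>h \<ge> 1\<close>.\<close>

lemma exact_degree_rep:
  assumes "h \<ge> 1"
  shows "ept_rep V E VT ET P \<Longrightarrow> helly_rep V P \<Longrightarrow> \<forall>z\<in>VT. degree ET z \<le> h \<Longrightarrow> w \<in> VT \<Longrightarrow>
    helly_h22 h V E"
proof (induction "h - degree ET w" arbitrary: VT ET P)
  case 0
  have VT: "finite VT"
    using "0.prems"(1) unfolding ept_rep_def is_tree_def by blast
  have "max_degree VT ET = h"
    unfolding max_degree_def
  proof (rule Max_eqI)
    show "h \<in> degree ET ` VT"
      using "0.prems"(3,4) "0.hyps" by (intro image_eqI[of _ _ w]) auto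
  qed (use VT "0.prems" in auto)
  then show ?case
    using "0.prems" unfolding helly_h22_def by blast
next
  case (Suc d)
  interpret host_tree VT ET
    using Suc.prems by unfold_locales (auto simp: ept_rep_def)
  obtain w' where w': "w' \<notin> VT"
    using finite_VT ex_new_if_finite infinite_UNIV_nat by blast
  let ?ET = "split_edges ET w w' {}"
  obtain P' where P': "ept_rep V E (insert w' VT) ?ET P'" "helly_rep V P'"
    using split_rep[OF Suc.prems(1,2,4) w', of "{}"] by (auto simp: crosses_def)
  note deg = degree_split[OF tree Suc.prems(4) w', of "{}"]
  have "degree ?ET w = Suc (degree ET w)"
    using deg(1) by (simp add: degree_eq)
  moreover have "degree ?ET z \<le> h" if "z \<in> insert w' VT" for z
    using that deg(2) deg(3)[of z] Suc.prems(3) Suc.hyps(2) calculation assms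
    by (cases "z = w"; cases "z = w'") auto
  ultimately show ?case
    using Suc.hyps P' Suc.prems(4) by (intro Suc.hyps(1)[OF _ P']) auto
qed

theorem theorem13:
  fixes V :: "'a set" and E :: "'a \<Rightarrow> 'a \<Rightarrow> bool" and h :: nat
  assumes "simple_graph V E"
    and "helly_ept V E"
    and "h \<ge> 3"
  shows "helly_h22 h V E \<longleftrightarrow> (\<forall>A. is_atom V E A \<longrightarrow> card (cliques A E) \<le> h)"
proof
  assume "helly_h22 h V E"
  then obtain VT ET P where R: "ept_rep V E VT ET P" "helly_rep V P" "max_degree VT ET = h"
    unfolding helly_h22_def by blast
  interpret helly_host VT ET V E P
    using R assms(1) by unfold_locales (auto simp: ept_rep_def)
  show "\<forall>A. is_atom V E A \<longrightarrow> card (cliques A E) \<le> h"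
  proof (intro allI impI)
    fix A assume "is_atom V E A"
    then obtain w where "w \<in> VT" "card (cliques A E) \<le> degree ET w"
      using card_cliques_le_degree unfolding is_atom_def by metis
    moreover from this have "degree ET w \<le> h"
      using R(3) finite_VT unfolding max_degree_def by auto
    ultimately show "card (cliques A E) \<le> h"
      by linarith
  qed
next
  assume atoms: "\<forall>A. is_atom V E A \<longrightarrow> card (cliques A E) \<le> h"
  obtain VT ET P where "ept_rep V E VT ET P" "helly_rep V P"
    using assms(2) unfolding helly_ept_def by blast
  then obtain VT' ET' P' where rep: "ept_rep V E VT' ET' P'" "helly_rep V P'"
      "\<forall>z\<in>VT'. degree ET' z \<le> h"
    using bounded_degree_rep[OF assms(1,3)] atoms by blast
  moreover obtain w where "w \<in> VT'"
    using rep(1) unfolding ept_rep_def is_tree_def by blast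
  ultimately show "helly_h22 h V E"
    using assms(3) by (intro exact_degree_rep[of h V E VT' ET' P' w]) auto
qed

end
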